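(* There exists exactly one multiresolution analysis in $L^2(\mathbb{Q}_p)$ that is generated by an orthogonal scaling function which is a test function; that is, if $\phi_1,\phi_2$ are test functions, each of which is an orthogonal scaling function of an MRA $\{V^{(1)}_j\}_{j\in\mathbb{Z}}$, resp. $\{V^{(2)}_j\}_{j\in\mathbb{Z}}$, with $V^{(i)}_j=\overline{\operatorname{span}\{\phi_i(p^{-j}x-a):a\in I_p\}}$, then $V^{(1)}_j=V^{(2)}_j$ for all $j\in\mathbb{Z}$, and such an MRA exists.
   Context: $p$ is a prime, $\mathbb{Q}_p$ the field of $p$-adic numbers with norm $|\cdot|_p$. The fractional part of $x=p^{\gamma}\sum_{j\ge0}x_jp^j$ ($x_j\in\{0,\dots,p-1\}$, $x_0\ne0$) is $\{x\}_p=p^{\gamma}\sum_{j=0}^{-\gamma-1}x_jp^j$, $\{0\}_p=0$; $I_p=\{a\in\mathbb{Q}_p:\{a\}_p=a\}$. A test function is a locally constant compactly supported complex function on $\mathbb{Q}_p$. Closures are in $L^2(\mathbb{Q}_p)$ (Haar measure). A collection of closed subspaces $V_j\subset L^2(\mathbb{Q}_p)$, $j\in\mathbb{Z}$, is an MRA if: (a) $V_j\subset V_{j+1}$; (b) $\bigcup_jV_j$ is dense in $L^2(\mathbb{Q}_p)$; (c) $\bigcap_jV_j=\{0\}$; (d) $f(\cdot)\in V_j\iff f(p^{-1}\cdot)\in V_{j+1}$; (e) there is $\phi\in V_0$ with $V_0=\overline{\operatorname{span}\{\phi(x-a):a\in I_p\}}$ (a scaling function); then $V_j=\overline{\operatorname{span}\{\phi(p^{-j}x-a):a\in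 I_p\}}$. A scaling function $\phi$ is orthogonal if $\{\phi(x-a):a\in I_p\}$ is an orthonormal basis of $V_0$. *)

theory Defs
  imports "HOL-Analysis.Analysis"
begin

text \<open>An element x = sum_j x_j p^j of Q_p is represented by its digit function
  d :: int => nat (d k is the coefficient of p^k), with all digits < p and only
  finitely many nonzero digits at negative positions.\<close>

type_synonym qp = "int \<Rightarrow> nat"

definition Qp :: "nat \<Rightarrow> qp set" where
  "Qp p = {d. (\<forall>k. d k < p) \<and> (\<exists>N. \<forall>k<N. d k = 0)}"

definition qp_zero :: qp where
  "qp_zero = (\<lambda>k. 0)"

text \<open>Truncation: the rational number sum_{j<n} x_j p^j (a representative of the class
  of x in Q_p / p^n Z_p).\<close>
definition qp_trunc :: "nat \<Rightarrow> qp \<Rightarrow> int \<Rightarrow> rat" where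
  "qp_trunc p x n = (\<Sum>j\<in>{j. j < n \<and> x j \<noteq> 0}. of_nat (x j) * (of_nat p) powi j)"

definition qcong :: "nat \<Rightarrow> int \<Rightarrow> rat \<Rightarrow> rat \<Rightarrow> bool" where
  "qcong p n a b \<longleftrightarrow> (a - b) / ((of_nat p) powi n) \<in> \<int>"

definition qp_sub :: "nat \<Rightarrow> qp \<Rightarrow> qp \<Rightarrow> qp" where
  "qp_sub p x y = (THE z. z \<in> Qp p \<and>
      (\<forall>n. qcong p n (qp_trunc p z n) (qp_trunc p x n - qp_trunc p y n)))"

text \<open>Multiplication by p^m (m an integer): shift of digits.\<close>
definition qp_ppow :: "int \<Rightarrow> qp \<Rightarrow> qp" where
  "qp_ppow m x = (\<lambda>k. x (k - m))"

definition qp_norm :: "nat \<Rightarrow> qp \<Rightarrow> real" where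
  "qp_norm p x = (if (\<forall>k. x k = 0) then 0
     else real p powr (- real_of_int (THE g. x g \<noteq> 0 \<and> (\<forall>k<g. x k = 0))))"

definition qp_frac :: "qp \<Rightarrow> qp" where
  "qp_frac x = (\<lambda>k. if k < 0 then x k else 0)"

definition Ip :: "nat \<Rightarrow> qp set" where
  "Ip p = {a \<in> Qp p. qp_frac a = a}"

text \<open>Borel sigma-algebra of Q_p: generated by the digit cylinders (equivalently by the balls).\<close>
definition qp_sets :: "nat \<Rightarrow> qp measure" where
  "qp_sets p = sigma (Qp p) {{x \<in> Qp p. x k = c} | k c. True}"

text \<open>Inverse Monna map [0,oo) -> Q_p: t = sum_i e_i p^i (standard base-p expansion)
  is sent to the p-adic number whose digit at position k is e_(-k-1).
  This map is measure-preserving from Lebesgue measure onto the Haar measure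
  normalised by mu(Z_p) = 1 (it misses only a countable set).\<close>
definition monna_inv :: "nat \<Rightarrow> real \<Rightarrow> qp" where
  "monna_inv p t = (\<lambda>k. nat (\<lfloor>t * real p powr real_of_int (k + 1)\<rfloor> mod int p))"

definition haar :: "nat \<Rightarrow> qp measure" where
  "haar p = distr (restrict_space lborel {0::real..}) (qp_sets p) (monna_inv p)"

definition L2 :: "nat \<Rightarrow> (qp \<Rightarrow> complex) set" where
  "L2 p = {f. f \<in> borel_measurable (haar p) \<and> integrable (haar p) (\<lambda>x. (cmod (f x))\<^sup>2)}"

definition l2inner :: "nat \<Rightarrow> (qp \<Rightarrow> complex) \<Rightarrow> (qp \<Rightarrow> complex) \<Rightarrow> complex" where
  "l2inner p f g = (LINT x|haar p. f x * cnj (g x))"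

definition l2norm :: "nat \<Rightarrow> (qp \<Rightarrow> complex) \<Rightarrow> real" where
  "l2norm p f = sqrt (LINT x|haar p. (cmod (f x))\<^sup>2)"

text \<open>Closure in L^2 (functions are not quotiented by a.e. equality; closures are
  automatically saturated under a.e. equality).\<close>
definition l2_closure :: "nat \<Rightarrow> (qp \<Rightarrow> complex) set \<Rightarrow> (qp \<Rightarrow> complex) set" where
  "l2_closure p S = {f \<in> L2 p. \<forall>e>0. \<exists>g\<in>S. l2norm p (\<lambda>x. f x - g x) < e}"

definition cspan :: "('a \<Rightarrow> complex) set \<Rightarrow> ('a \<Rightarrow> complex) set" where
  "cspan S = {f. \<exists>F c. finite F \<and> F \<subseteq> S \<and> f = (\<lambda>x. \<Sum>g\<in>F. c g * g x)}"

definition csubspace :: "('a \<Rightarrow> complex) set \<Rightarrow> bool" where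
  "csubspace V \<longleftrightarrow> (\<lambda>x. 0) \<in> V \<and> (\<forall>f\<in>V. \<forall>g\<in>V. (\<lambda>x. f x + g x) \<in> V)
     \<and> (\<forall>c. \<forall>f\<in>V. (\<lambda>x. c * f x) \<in> V)"

text \<open>Locally constant with compact support (a subset of Q_p has compact closure iff it
  is bounded).\<close>
definition qp_test :: "nat \<Rightarrow> (qp \<Rightarrow> complex) \<Rightarrow> bool" where
  "qp_test p f \<longleftrightarrow>
     (\<forall>x\<in>Qp p. \<exists>e>0. \<forall>y\<in>Qp p. qp_norm p (qp_sub p y x) < e \<longrightarrow> f y = f x) \<and>
     (\<exists>R. \<forall>x\<in>Qp p. qp_norm p x > R \<longrightarrow> f x = 0)"

definition qp_transl :: "nat \<Rightarrow> qp \<Rightarrow> (qp \<Rightarrow> complex) \<Rightarrow> (qp \<Rightarrow> complex)" where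
  "qp_transl p a f = (\<lambda>x. f (qp_sub p x a))"

definition is_scaling_function :: "nat \<Rightarrow> (int \<Rightarrow> (qp \<Rightarrow> complex) set) \<Rightarrow> (qp \<Rightarrow> complex) \<Rightarrow> bool" where
  "is_scaling_function p V phi \<longleftrightarrow>
     phi \<in> V 0 \<and> V 0 = l2_closure p (cspan {qp_transl p a phi | a. a \<in> Ip p})"

definition is_MRA :: "nat \<Rightarrow> (int \<Rightarrow> (qp \<Rightarrow> complex) set) \<Rightarrow> bool" where
  "is_MRA p V \<longleftrightarrow>
     (\<forall>j. V j \<subseteq> L2 p \<and> csubspace (V j) \<and> l2_closure p (V j) = V j) \<and>
     (\<forall>j. V j \<subseteq> V (j + 1)) \<and>
     l2_closure p (\<Union>j. V j) = L2 p \<and>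
     (\<forall>f\<in>(\<Inter>j. V j). l2norm p f = 0) \<and>
     (\<forall>j f. f \<in> V j \<longleftrightarrow> (\<lambda>x. f (qp_ppow (-1) x)) \<in> V (j + 1)) \<and>
     (\<exists>phi. is_scaling_function p V phi)"

definition is_orth_scaling_function :: "nat \<Rightarrow> (int \<Rightarrow> (qp \<Rightarrow> complex) set) \<Rightarrow> (qp \<Rightarrow> complex) \<Rightarrow> bool" where
  "is_orth_scaling_function p V phi \<longleftrightarrow>
     is_scaling_function p V phi \<and>
     (\<forall>a\<in>Ip p. \<forall>b\<in>Ip p.
        l2inner p (qp_transl p a phi) (qp_transl p b phi) = (if a = b then 1 else 0))"

end

theory Submission
  imports Defs "HOL-Number_Theory.Cong" "HOL-Computational_Algebra.Polynomial"
begin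

text \<open>
  Uniqueness. Let \<open>\<phi>\<close> be an orthogonal scaling test function, supported in \<open>p\<^sup>-\<^sup>N \<int>\<^sub>p\<close>; by compactness
  \<open>\<phi> x = u (p\<^sup>N x mod p\<^sup>m)\<close> there, for a \<open>p\<^sup>m\<close>-periodic sequence \<open>u\<close> on the integers. With
  \<open>n = p\<^sup>N\<close> and \<open>T\<close> the translation by \<open>1 / p\<^sup>N\<close>, the inclusion \<open>V\<^sub>0 \<subseteq> V\<^sub>1\<close> says that \<open>T\<^sup>k \<phi>\<close> with
  \<open>k < n\<close> is a combination of \<open>T\<^sup>j \<psi>\<close> with \<open>j < p n\<close>, where \<open>\<psi> x = \<phi> (x / p)\<close>. Comparing the degrees of
  polynomials in \<open>T\<close> that annihilate \<open>\<phi>\<close> and \<open>\<psi>\<close>, one finds that \<open>\<phi>\<close> is annihilated by a polynomial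
  of degree at most \<open>n\<close>, so \<open>T\<^sup>n \<phi>\<close> is a combination of \<open>T\<^sup>k \<phi>\<close> with \<open>k < n\<close>. By orthogonality
  \<open>T\<^sup>n \<phi> = c \<phi>\<close>. Periodicity gives \<open>c\<close> to the power \<open>p\<^sup>e\<close> equal to 1 for some \<open>e\<close>, and \<open>\<phi>\<close> being a
  combination of translates of \<open>\<psi>\<close> gives \<open>c\<^sup>p = c\<close>, whence \<open>c = 1\<close>. Thus \<open>\<phi>\<close> is \<open>\<int>\<^sub>p\<close>-periodic,
  and \<open>V\<^sub>0\<close> is the closed span of the indicators of the cosets of \<open>\<int>\<^sub>p\<close>.

  Existence. The closed spans of the indicators of balls of radius \<open>p\<^sup>-\<^sup>j\<close> form a multiresolution analysis.
  Density follows from a Dynkin argument, and a function in the intersection is constant on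
  arbitrarily large balls, hence zero almost everywhere.
\<close>

section \<open>Haar measure of balls\<close>

locale padic =
  fixes p :: nat
  assumes p_gt_1: "1 < p"
begin

definition qball :: "int \<Rightarrow> qp \<Rightarrow> qp set" where
  "qball j b = {x \<in> Qp p. \<forall>k<j. x k = b k}"

text \<open>The subgroup \<open>p^(-N) Z_p\<close>, on which scaling by \<open>p^N\<close> allows
  computation with integers.\<close>

definition disc :: "nat \<Rightarrow> qp set" where
  "disc N = {x \<in> Qp p. \<forall>k < - int N. x k = 0}"

text \<open>For \<open>t \<ge> 0\<close> this single integer packs all digits of
  \<open>monna_inv p t\<close> below position \<open>k\<close>, so agreement of digits becomes one
  equation between integers.\<close>

definition monna_floor :: "real \<Rightarrow> int \<Rightarrow> int" where
  "monna_floor t k = \<lfloor>t * real p powr real_of_int k\<rfloor>"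

lemma p_pos [simp]: "0 < p" "p \<noteq> 0"
  using p_gt_1 by auto

lemma zero_in_Qp: "qp_zero \<in> Qp p"
  using p_gt_1 by (auto simp: Qp_def qp_zero_def)

lemma disc_eq_qball: "disc N = qball (- int N) qp_zero"
  by (simp add: disc_def qball_def qp_zero_def)

lemma Qp_ex_disc:
  assumes "x \<in> Qp p"
  obtains N where "x \<in> disc N" "N0 \<le> N"
proof -
  from assms obtain K where K: "\<forall>k<K. x k = 0" by (auto simp: Qp_def)
  have "x \<in> disc (max N0 (nat (- K)))" using assms K by (auto simp: disc_def)
  then show ?thesis using that by auto
qed

lemma disc_mono: "N \<le> M \<Longrightarrow> disc N \<subseteq> disc M"
  by (auto simp: disc_def)

lemma disc_subset_Qp: "disc N \<subseteq> Qp p"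
  by (auto simp: disc_def)

lemma Qp_eq_Union_disc: "Qp p = (\<Union>N. disc N)"
  by (auto intro: Qp_ex_disc[where ?N0.0 = 0] subsetD[OF disc_subset_Qp])

section \<open>Digits of the inverse Monna map\<close>

lemma monna_inv_conv: "monna_inv p t k = nat (monna_floor t (k + 1) mod int p)"
  by (simp add: monna_inv_def monna_floor_def)

lemma monna_floor_div: "monna_floor t k = monna_floor t (k + 1) div int p"
proof -
  have "t * real p powr real_of_int k = t * real p powr real_of_int (k + 1) / real_of_int (int p)"
    by (simp add: powr_add)
  then show ?thesis
    unfolding monna_floor_def by (simp only: floor_divide_real_eq_div of_nat_0_le_iff)
qed

lemma monna_floor_Suc: "monna_floor t (k + 1) = int p * monna_floor t k + int (monna_inv p t k)"
  unfolding monna_inv_conv monna_floor_div[of t k] by simp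

lemma monna_floor_eventually_0:
  assumes "0 \<le> t"
  shows "\<exists>K. \<forall>k\<le>K. monna_floor t k = 0"
proof -
  obtain n where n: "t < real p ^ n"
    using real_arch_pow[of "real p" t] p_gt_1 by auto
  have "monna_floor t k = 0" if "k \<le> - int n" for k
  proof -
    have "real p powr real_of_int k \<le> real p powr (- real n)"
      using that p_gt_1 by (intro powr_mono) auto
    then have "t * real p powr real_of_int k \<le> t * real p powr (- real n)"
      using assms by (intro mult_left_mono) auto
    also have "\<dots> < real p ^ n * real p powr (- real n)"
      using n by (intro mult_strict_right_mono) auto
    also have "\<dots> = 1"
      by (simp add: powr_realpow [symmetric] powr_add [symmetric])
    finally show ?thesis
      unfolding monna_floor_def using assms by (simp add: floor_eq_iff)
  qed
  then show ?thesis by blast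
qed

lemma monna_inv_in_Qp:
  assumes "0 \<le> t"
  shows "monna_inv p t \<in> Qp p"
proof -
  obtain K where K: "\<forall>k\<le>K. monna_floor t k = 0"
    using monna_floor_eventually_0[OF assms] by blast
  have "\<forall>k<K. monna_inv p t k = 0"
    using K by (simp add: monna_inv_conv)
  moreover have "monna_inv p t k < p" for k
    unfolding monna_inv_conv by (simp add: nat_less_iff)
  ultimately show ?thesis by (auto simp: Qp_def)
qed

text \<open>Floors at lower positions are successive quotients by \<open>p\<close>, so equality at
  \<open>j\<close> passes down. Conversely, both floors vanish far to the left, and the recursion
  rebuilds them digit by digit.\<close>

lemma monna_inv_agree_iff:
  assumes "0 \<le> t" "0 \<le> s"
  shows "(\<forall>k<j. monna_inv p t k = monna_inv p s k) \<longleftrightarrow> monna_floor t j = monna_floor s j"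
proof
  assume agree: "\<forall>k<j. monna_inv p t k = monna_inv p s k"
  obtain K1 where K1: "\<forall>k\<le>K1. monna_floor t k = 0"
    using monna_floor_eventually_0[OF assms(1)] by blast
  obtain K2 where K2: "\<forall>k\<le>K2. monna_floor s k = 0"
    using monna_floor_eventually_0[OF assms(2)] by blast
  define K where "K = min j (min K1 K2)"
  have "i \<le> j \<longrightarrow> monna_floor t i = monna_floor s i" if "K \<le> i" for i
    using that
  proof (induction i rule: int_ge_induct)
    case base
    have "K \<le> K1" "K \<le> K2" by (auto simp: K_def)
    then show ?case using K1 K2 by metis
  next
    case (step i)
    show ?case
    proof
      assume "i + 1 \<le> j"
      then have "monna_floor t i = monna_floor s i" "monna_inv p t i = monna_inv p s i"
        using step agree by auto
      then show "monna_floor t (i + 1) = monna_floor s (i + 1)"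
        unfolding monna_floor_Suc by simp
    qed
  qed
  then show "monna_floor t j = monna_floor s j" by (simp add: K_def)
next
  assume eq: "monna_floor t j = monna_floor s j"
  have "monna_floor t i = monna_floor s i" if "i \<le> j" for i
    using that
  proof (induction i rule: int_le_induct)
    case base
    then show ?case by (fact eq)
  next
    case (step i)
    then show ?case unfolding monna_floor_div[of _ "i - 1"] by simp
  qed
  then show "\<forall>k<j. monna_inv p t k = monna_inv p s k"
    by (auto simp: monna_inv_conv)
qed

lemma monna_floor_of_int_div [simp]:
  "monna_floor (real_of_int i / real p powr real_of_int j) j = i"
  by (simp add: monna_floor_def)

text \<open>Only finitely many digits below \<open>j\<close> are nonzero, so the prefix of
  \<open>b\<close> is a terminating expansion. Prescribing only a prefix avoids the elements missed
  by \<open>monna_inv\<close>.\<close>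

lemma ex_monna_inv_agree:
  assumes b: "b \<in> Qp p"
  shows "\<exists>i\<ge>0. \<forall>k<j. monna_inv p (real_of_int i / real p powr real_of_int j) k = b k"
proof -
  obtain K where K: "\<forall>k<K. b k = 0" using b by (auto simp: Qp_def)
  have zero: "\<exists>i\<ge>0. \<forall>k<j. monna_inv p (real_of_int i / real p powr real_of_int j) k = b k"
    if "j \<le> K" for j
    using K that by (intro exI[of _ 0]) (auto simp: monna_inv_def)
  show ?thesis
  proof (cases "j \<le> K")
    case True
    then show ?thesis by (rule zero)
  next
    case False
    then have "K \<le> j" by simp
    then show ?thesis
    proof (induction j rule: int_ge_induct)
      case base
      show ?case by (rule zero) simp
    next
      case (step j)
      then obtain i where i: "0 \<le> i"
        "\<forall>k<j. monna_inv p (real_of_int i / real p powr real_of_int j) k = b k" by blast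
      \<comment> \<open>Appending the digit \<open>b j\<close> multiplies the old numerator by
        \<open>p\<close>; dividing by \<open>p\<close> again recovers the old prefix.\<close>
      define i' where "i' = int p * i + int (b j)"
      define t where "t = real_of_int i' / real p powr real_of_int (j + 1)"
      have bj: "b j < p" using b by (auto simp: Qp_def)
      have i': "0 \<le> i'" using i by (simp add: i'_def)
      have t0: "0 \<le> t" using i' by (simp add: t_def)
      have fl: "monna_floor t (j + 1) = i'" unfolding t_def by (rule monna_floor_of_int_div)
      have "monna_floor t j = i"
        using bj unfolding monna_floor_div[of t j] fl by (simp add: i'_def)
      then have "\<forall>k<j. monna_inv p t k = monna_inv p (real_of_int i / real p powr real_of_int j) k"
        using i t0 by (subst monna_inv_agree_iff) auto
      moreover have "monna_inv p t j = b j"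
        unfolding monna_inv_conv fl using bj by (simp add: i'_def)
      ultimately have "\<forall>k<j+1. monna_inv p t k = b k"
        using i by (metis zless_add1_eq)
      then show ?case using i' unfolding t_def by blast
    qed
  qed
qed

text \<open>By agreement of floors, the preimage consists of the \<open>t\<close> with
  \<open>monna_floor t j = i\<close>; the length of this interval gives the measure of the
  ball.\<close>

lemma monna_inv_vimage_qball:
  assumes b: "b \<in> Qp p"
  shows "\<exists>i\<ge>0. {t. 0 \<le> t \<and> monna_inv p t \<in> qball j b} =
    {real_of_int i / real p powr real_of_int j ..< (real_of_int i + 1) / real p powr real_of_int j}"
proof -
  obtain i where i: "0 \<le> i"
    "\<forall>k<j. monna_inv p (real_of_int i / real p powr real_of_int j) k = b k"
    using ex_monna_inv_agree[OF b] by blast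
  have pos: "0 < real p powr real_of_int j" by simp
  have "monna_inv p t \<in> qball j b \<longleftrightarrow> monna_floor t j = i" if "0 \<le> t" for t
    using monna_inv_agree_iff[OF that, of "real_of_int i / real p powr real_of_int j" j] i
      monna_inv_in_Qp[OF that] by (auto simp: qball_def)
  moreover have "0 \<le> t" if "real_of_int i / real p powr real_of_int j \<le> t" for t
    using order.trans[OF _ that] i by simp
  moreover have "monna_floor t j = i \<longleftrightarrow>
    t \<in> {real_of_int i / real p powr real_of_int j ..< (real_of_int i + 1) / real p powr real_of_int j}" for t
    using pos by (simp add: monna_floor_def floor_eq_iff field_simps)
  ultimately show ?thesis using i(1) by (intro exI[of _ i]) auto
qed

section \<open>Borel sets and the measure of balls\<close>

lemma qp_cylinders_Pow: "{{x \<in> Qp p. x k = c} | k c. True} \<subseteq> Pow (Qp p)"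
  by auto

lemma space_qp_sets [simp]: "space (qp_sets p) = Qp p"
  unfolding qp_sets_def by (rule space_measure_of) (rule qp_cylinders_Pow)

lemma sets_qp_sets: "sets (qp_sets p) = sigma_sets (Qp p) {{x \<in> Qp p. x k = c} | k c. True}"
  unfolding qp_sets_def by (rule sets_measure_of) (rule qp_cylinders_Pow)

lemma space_haar [simp]: "space (haar p) = Qp p"
  by (simp add: haar_def)

lemma sets_haar: "sets (haar p) = sets (qp_sets p)"
  by (simp add: haar_def)

lemma measurable_monna_inv [measurable]:
  "monna_inv p \<in> measurable (restrict_space lborel {0..}) (qp_sets p)"
  unfolding qp_sets_def
proof (rule measurable_measure_of[OF qp_cylinders_Pow])
  show "monna_inv p \<in> space (restrict_space lborel {0..}) \<rightarrow> Qp p"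
    using monna_inv_in_Qp by (auto simp: space_restrict_space)
  fix y assume "y \<in> {{x \<in> Qp p. x k = c} |k c. True}"
  then obtain k c where y: "y = {x \<in> Qp p. x k = c}" by auto
  have "monna_inv p -` y \<inter> space (restrict_space lborel {0..}) =
    {t \<in> space lborel. nat (\<lfloor>t * real p powr real_of_int (k + 1)\<rfloor> mod int p) = c} \<inter> {0..}"
    using monna_inv_in_Qp by (auto simp: space_restrict_space y monna_inv_def)
  also have "\<dots> \<in> sets (restrict_space lborel {0..})"
    by (rule sets_restrict_space_iff[THEN iffD2]) auto
  finally show "monna_inv p -` y \<inter> space (restrict_space lborel {0..})
    \<in> sets (restrict_space lborel {0..})" .
qed

lemma digit_measurable: "{x \<in> Qp p. x k = c} \<in> sets (haar p)"
  by (auto simp: sets_haar sets_qp_sets)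

lemma qball_sets [measurable, simp]: "qball j b \<in> sets (haar p)"
proof -
  have "qball j b = Qp p \<inter> (\<Inter>k\<in>{..<j}. {x \<in> Qp p. x k = b k})"
    by (auto simp: qball_def)
  moreover have "Qp p \<in> sets (haar p)" using sets.top[of "haar p"] by simp
  moreover have "(\<Inter>k\<in>{..<j}. {x \<in> Qp p. x k = b k}) \<in> sets (haar p)"
    by (rule sets.countable_INT') (use digit_measurable in auto)
  ultimately show ?thesis by auto
qed

lemma emeasure_qball:
  assumes b: "b \<in> Qp p"
  shows "emeasure (haar p) (qball j b) = ennreal (real p powr (- real_of_int j))"
proof -
  obtain i where i: "0 \<le> i" "{t. 0 \<le> t \<and> monna_inv p t \<in> qball j b} =
    {real_of_int i / real p powr real_of_int j ..< (real_of_int i + 1) / real p powr real_of_int j}"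
    (is "_ = ?I") using monna_inv_vimage_qball[OF b] by blast
  have "emeasure (haar p) (qball j b) =
    emeasure (restrict_space lborel {0..}) (monna_inv p -` qball j b \<inter> space (restrict_space lborel {0..}))"
    using qball_sets[unfolded sets_haar] unfolding haar_def by (intro emeasure_distr) auto
  also have "monna_inv p -` qball j b \<inter> space (restrict_space lborel {0..}) = ?I"
    unfolding i(2)[symmetric] by (auto simp: space_restrict_space)
  also have "emeasure (restrict_space lborel {0..}) ?I = emeasure lborel ?I"
    using i(2) by (intro emeasure_restrict_space) auto
  also have "\<dots> = ennreal (real p powr (- real_of_int j))"
    by (simp add: divide_right_mono diff_divide_distrib[symmetric] powr_minus_divide)
  finally show ?thesis .
qed

lemma measure_qball: "b \<in> Qp p \<Longrightarrow> measure (haar p) (qball j b) = real p powr (- real_of_int j)"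
  by (simp add: measure_def emeasure_qball)


section \<open>Square-integrable functions\<close>

text \<open>Squared norms keep square roots out of the estimates.\<close>

definition l2sq :: "(qp \<Rightarrow> complex) \<Rightarrow> real" where
  "l2sq f = (LINT x|haar p. (cmod (f x))\<^sup>2)"

lemma l2sq_nonneg: "0 \<le> l2sq f"
  unfolding l2sq_def by simp

lemma l2norm_conv: "l2norm p f = sqrt (l2sq f)"
  by (simp add: l2norm_def l2sq_def)

lemma L2_measurable [measurable_dest]: "f \<in> L2 p \<Longrightarrow> f \<in> borel_measurable (haar p)"
  by (simp add: L2_def)

lemma L2_integrable: "f \<in> L2 p \<Longrightarrow> integrable (haar p) (\<lambda>x. (cmod (f x))\<^sup>2)"
  by (simp add: L2_def)

lemma cmod_add_sq_le: "(cmod (a + b))\<^sup>2 \<le> 2 * (cmod a)\<^sup>2 + 2 * (cmod b)\<^sup>2"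
proof -
  have "(cmod (a + b))\<^sup>2 \<le> (cmod a + cmod b)\<^sup>2"
    by (intro power_mono norm_triangle_ineq) simp
  also have "\<dots> \<le> 2 * (cmod a)\<^sup>2 + 2 * (cmod b)\<^sup>2"
    using sum_squares_bound[of "cmod a" "cmod b"] by (simp add: power2_sum)
  finally show ?thesis .
qed

lemma L2_zero [simp]: "(\<lambda>x. 0) \<in> L2 p"
  by (simp add: L2_def)

lemma L2_cmult [intro]: "f \<in> L2 p \<Longrightarrow> (\<lambda>x. c * f x) \<in> L2 p"
  by (auto simp: L2_def norm_mult power_mult_distrib)

lemma L2_add [intro]:
  assumes f: "f \<in> L2 p" and g: "g \<in> L2 p"
  shows "(\<lambda>x. f x + g x) \<in> L2 p"
proof -
  note [measurable] = L2_measurable[OF f] L2_measurable[OF g]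
  have "integrable (haar p) (\<lambda>x. (cmod (f x + g x))\<^sup>2)"
  proof (rule Bochner_Integration.integrable_bound)
    show "integrable (haar p) (\<lambda>x. 2 * (cmod (f x))\<^sup>2 + 2 * (cmod (g x))\<^sup>2)"
      using L2_integrable[OF f] L2_integrable[OF g] by auto
    show "AE x in haar p. norm ((cmod (f x + g x))\<^sup>2) \<le> norm (2 * (cmod (f x))\<^sup>2 + 2 * (cmod (g x))\<^sup>2)"
      by (intro AE_I2) (use cmod_add_sq_le in auto)
  qed measurable
  then show ?thesis by (simp add: L2_def)
qed

lemma L2_diff [intro]: "f \<in> L2 p \<Longrightarrow> g \<in> L2 p \<Longrightarrow> (\<lambda>x. f x - g x) \<in> L2 p"
  using L2_add[of f "\<lambda>x. (-1) * g x"] L2_cmult[of g "-1"] by simp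

text \<open>A substitute for Minkowski's inequality, obtained by integrating
  \<open>cmod_add_sq_le\<close>; the factor 2 is harmless because approximation errors can be chosen
  small.\<close>

lemma l2sq_add_le:
  assumes f: "f \<in> L2 p" and g: "g \<in> L2 p"
  shows "l2sq (\<lambda>x. f x + g x) \<le> 2 * l2sq f + 2 * l2sq g"
proof -
  have "l2sq (\<lambda>x. f x + g x) \<le> (LINT x|haar p. 2 * (cmod (f x))\<^sup>2 + 2 * (cmod (g x))\<^sup>2)"
    unfolding l2sq_def
    using L2_integrable[OF f] L2_integrable[OF g] L2_integrable[OF L2_add[OF f g]]
    by (intro integral_mono cmod_add_sq_le) auto
  also have "\<dots> = 2 * l2sq f + 2 * l2sq g"
    unfolding l2sq_def using L2_integrable[OF f] L2_integrable[OF g] by simp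
  finally show ?thesis .
qed

lemma l2sq_cmult: "l2sq (\<lambda>x. c * f x) = (cmod c)\<^sup>2 * l2sq f"
  by (simp add: l2sq_def norm_mult power_mult_distrib)

lemma l2sq_mono:
  assumes f: "f \<in> L2 p" and g: "g \<in> L2 p"
    and le: "\<And>x. x \<in> Qp p \<Longrightarrow> cmod (f x) \<le> cmod (g x)"
  shows "l2sq f \<le> l2sq g"
  unfolding l2sq_def
  using L2_integrable[OF f] L2_integrable[OF g] le by (intro integral_mono power_mono) auto

lemma L2_cong: "(\<And>x. x \<in> Qp p \<Longrightarrow> f x = g x) \<Longrightarrow> f \<in> L2 p \<longleftrightarrow> g \<in> L2 p"
  unfolding L2_def mem_Collect_eq
  by (intro conj_cong measurable_cong Bochner_Integration.integrable_cong) auto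

lemma l2sq_cong: "(\<And>x. x \<in> Qp p \<Longrightarrow> f x = g x) \<Longrightarrow> l2sq f = l2sq g"
  unfolding l2sq_def by (intro Bochner_Integration.integral_cong) auto

section \<open>Closures and spans in L2\<close>

lemma l2_closure_iff:
  "f \<in> l2_closure p S \<longleftrightarrow> f \<in> L2 p \<and> (\<forall>e>0. \<exists>g\<in>S. l2sq (\<lambda>x. f x - g x) < e)"
proof -
  have "(\<forall>e>0. \<exists>g\<in>S. sqrt (l2sq (\<lambda>x. f x - g x)) < e) \<longleftrightarrow> (\<forall>e>0. \<exists>g\<in>S. l2sq (\<lambda>x. f x - g x) < e)"
    (is "?A \<longleftrightarrow> ?B")
  proof
    assume A: ?A
    show ?B
    proof (intro allI impI)
      fix e :: real assume "e > 0"
      with A obtain g where "g \<in> S" "sqrt (l2sq (\<lambda>x. f x - g x)) < sqrt e"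
        using real_sqrt_gt_zero by blast
      then show "\<exists>g\<in>S. l2sq (\<lambda>x. f x - g x) < e" by auto
    qed
  next
    assume B: ?B
    show ?A
    proof (intro allI impI)
      fix e :: real assume e: "e > 0"
      then have "e\<^sup>2 > 0" by simp
      with B obtain g where "g \<in> S" "l2sq (\<lambda>x. f x - g x) < e\<^sup>2" by blast
      then show "\<exists>g\<in>S. sqrt (l2sq (\<lambda>x. f x - g x)) < e"
        using e l2sq_nonneg by (auto intro!: real_less_lsqrt)
    qed
  qed
  then show ?thesis by (simp add: l2_closure_def l2norm_conv)
qed

lemma l2_closure_subset_L2: "l2_closure p S \<subseteq> L2 p"
  by (auto simp: l2_closure_def)

lemma l2_closure_superset: "S \<subseteq> L2 p \<Longrightarrow> S \<subseteq> l2_closure p S"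
proof
  fix f assume "S \<subseteq> L2 p" "f \<in> S"
  then show "f \<in> l2_closure p S"
    unfolding l2_closure_iff by (auto intro!: bexI[of _ f] simp: l2sq_def)
qed

lemma l2_closure_mono: "S \<subseteq> T \<Longrightarrow> l2_closure p S \<subseteq> l2_closure p T"
  by (fastforce simp: l2_closure_def)

lemma l2_closure_idem:
  assumes S: "S \<subseteq> L2 p"
  shows "l2_closure p (l2_closure p S) = l2_closure p S"
proof
  show "l2_closure p S \<subseteq> l2_closure p (l2_closure p S)"
    by (intro l2_closure_superset l2_closure_subset_L2)
  show "l2_closure p (l2_closure p S) \<subseteq> l2_closure p S"
  proof
    fix f assume f: "f \<in> l2_closure p (l2_closure p S)"
    then have fL: "f \<in> L2 p" using l2_closure_subset_L2 by auto
    have "\<exists>h\<in>S. l2sq (\<lambda>x. f x - h x) < e" if e: "e > 0" for e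
    proof -
      \<comment> \<open>Two errors of \<open>e / 4\<close>, each doubled, add up to less than
        \<open>e\<close>.\<close>
      obtain g where g: "g \<in> l2_closure p S" "l2sq (\<lambda>x. f x - g x) < e / 4"
        using f e unfolding l2_closure_iff[of f] by (meson divide_pos_pos zero_less_numeral)
      obtain h where h: "h \<in> S" "l2sq (\<lambda>x. g x - h x) < e / 4"
        using g(1) e unfolding l2_closure_iff[of g] by (meson divide_pos_pos zero_less_numeral)
      have gL: "g \<in> L2 p" and hL: "h \<in> L2 p" using g h S l2_closure_subset_L2 by auto
      have "l2sq (\<lambda>x. f x - h x) = l2sq (\<lambda>x. (f x - g x) + (g x - h x))" by simp
      also have "\<dots> \<le> 2 * l2sq (\<lambda>x. f x - g x) + 2 * l2sq (\<lambda>x. g x - h x)"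
        using fL gL hL by (intro l2sq_add_le L2_diff)
      also have "\<dots> < e" using g h by simp
      finally show ?thesis using h by blast
    qed
    then show "f \<in> l2_closure p S" using fL by (auto simp: l2_closure_iff)
  qed
qed

lemma csubspace_l2_closure:
  assumes S: "S \<subseteq> L2 p" and sub: "csubspace S"
  shows "csubspace (l2_closure p S)"
  unfolding csubspace_def
proof (intro conjI ballI allI)
  have "(\<lambda>x. 0) \<in> S" using sub by (simp add: csubspace_def)
  then show "(\<lambda>x. 0) \<in> l2_closure p S" using l2_closure_superset[OF S] by auto
next
  fix f g assume f: "f \<in> l2_closure p S" and g: "g \<in> l2_closure p S"
  then have fL: "f \<in> L2 p" and gL: "g \<in> L2 p" using l2_closure_subset_L2 by auto
  have "\<exists>h\<in>S. l2sq (\<lambda>x. f x + g x - h x) < e" if e: "e > 0" for e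
  proof -
    obtain f' where f': "f' \<in> S" "l2sq (\<lambda>x. f x - f' x) < e / 4"
      using f e unfolding l2_closure_iff[of f] by (meson divide_pos_pos zero_less_numeral)
    obtain g' where g': "g' \<in> S" "l2sq (\<lambda>x. g x - g' x) < e / 4"
      using g e unfolding l2_closure_iff[of g] by (meson divide_pos_pos zero_less_numeral)
    have *: "f' \<in> L2 p" "g' \<in> L2 p" using f' g' S by auto
    have "l2sq (\<lambda>x. f x + g x - (f' x + g' x)) = l2sq (\<lambda>x. (f x - f' x) + (g x - g' x))"
      by (simp add: algebra_simps)
    also have "\<dots> \<le> 2 * l2sq (\<lambda>x. f x - f' x) + 2 * l2sq (\<lambda>x. g x - g' x)"
      using fL gL * by (intro l2sq_add_le L2_diff)
    also have "\<dots> < e" using f' g' by simp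
    finally show ?thesis
      using f' g' sub by (intro bexI[of _ "\<lambda>x. f' x + g' x"]) (auto simp: csubspace_def)
  qed
  then show "(\<lambda>x. f x + g x) \<in> l2_closure p S"
    using fL gL by (auto simp: l2_closure_iff)
next
  fix c f assume f: "f \<in> l2_closure p S"
  then have fL: "f \<in> L2 p" using l2_closure_subset_L2 by auto
  have "\<exists>h\<in>S. l2sq (\<lambda>x. c * f x - h x) < e" if e: "e > 0" for e
  proof -
    \<comment> \<open>Adding 1 keeps the divisor positive when \<open>c = 0\<close>.\<close>
    have pos: "0 < (cmod c)\<^sup>2 + 1" by (simp add: add_nonneg_pos)
    then obtain f' where f': "f' \<in> S" "l2sq (\<lambda>x. f x - f' x) < e / ((cmod c)\<^sup>2 + 1)"
      using f e unfolding l2_closure_iff[of f] by (meson divide_pos_pos)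
    have "l2sq (\<lambda>x. c * f x - c * f' x) = (cmod c)\<^sup>2 * l2sq (\<lambda>x. f x - f' x)"
      unfolding l2sq_cmult[symmetric] by (simp add: algebra_simps)
    also have "\<dots> \<le> ((cmod c)\<^sup>2 + 1) * l2sq (\<lambda>x. f x - f' x)"
      using l2sq_nonneg by (intro mult_right_mono) auto
    also have "\<dots> < e" using f'(2) pos by (simp add: pos_less_divide_eq mult.commute)
    finally show ?thesis
      using f' sub by (intro bexI[of _ "\<lambda>x. c * f' x"]) (auto simp: csubspace_def)
  qed
  then show "(\<lambda>x. c * f x) \<in> l2_closure p S"
    using fL by (auto simp: l2_closure_iff)
qed

lemma csubspaceD:
  assumes "csubspace V"
  shows "(\<lambda>x. 0) \<in> V"
    and "f \<in> V \<Longrightarrow> g \<in> V \<Longrightarrow> (\<lambda>x. f x + g x) \<in> V"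
    and "f \<in> V \<Longrightarrow> (\<lambda>x. c * f x) \<in> V"
  using assms by (auto simp: csubspace_def)

lemma csubspace_sum:
  assumes "csubspace V" "\<And>i. i \<in> I \<Longrightarrow> f i \<in> V"
  shows "(\<lambda>x. \<Sum>i\<in>I. c i * f i x) \<in> V"
  using assms(2)
proof (induction I rule: infinite_finite_induct)
  case (insert i I)
  then have "(\<lambda>x. c i * f i x) \<in> V" "(\<lambda>x. \<Sum>i\<in>I. c i * f i x) \<in> V"
    using assms(1) by (auto simp: csubspace_def)
  then show ?case using insert assms(1) by (auto simp: csubspace_def)
qed (use assms(1) in \<open>auto simp: csubspace_def\<close>)

lemma csubspace_cspan: "csubspace (cspan S)"
  unfolding csubspace_def
proof (intro conjI ballI allI)
  show "(\<lambda>x. 0) \<in> cspan S" by (auto simp: cspan_def intro!: exI[of _ "{}"])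
next
  fix f g assume "f \<in> cspan S" "g \<in> cspan S"
  then obtain F c G d where F: "finite F" "F \<subseteq> S" "f = (\<lambda>x. \<Sum>h\<in>F. c h * h x)"
    and G: "finite G" "G \<subseteq> S" "g = (\<lambda>x. \<Sum>h\<in>G. d h * h x)"
    by (auto simp: cspan_def)
  define e where "e = (\<lambda>h. (if h \<in> F then c h else 0) + (if h \<in> G then d h else 0))"
  have "f x + g x = (\<Sum>h\<in>F \<union> G. e h * h x)" for x
  proof -
    have "(\<Sum>h\<in>F \<union> G. (if h \<in> F then c h else 0) * h x) = (\<Sum>h\<in>F. c h * h x)"
      by (rule sum.mono_neutral_cong_right) (use F G in auto)
    moreover have "(\<Sum>h\<in>F \<union> G. (if h \<in> G then d h else 0) * h x) = (\<Sum>h\<in>G. d h * h x)"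
      by (rule sum.mono_neutral_cong_right) (use F G in auto)
    ultimately show ?thesis
      by (simp add: F G e_def distrib_right sum.distrib)
  qed
  then show "(\<lambda>x. f x + g x) \<in> cspan S"
    unfolding cspan_def using F G by (auto intro!: exI[of _ "F \<union> G"] exI[of _ e])
next
  fix a f assume "f \<in> cspan S"
  then obtain F c where F: "finite F" "F \<subseteq> S" "f = (\<lambda>x. \<Sum>h\<in>F. c h * h x)"
    by (auto simp: cspan_def)
  then show "(\<lambda>x. a * f x) \<in> cspan S"
    unfolding cspan_def
    by (auto intro!: exI[of _ F] exI[of _ "\<lambda>h. a * c h"] simp: sum_distrib_left mult.assoc)
qed

lemma cspan_minimal: "csubspace V \<Longrightarrow> S \<subseteq> V \<Longrightarrow> cspan S \<subseteq> V"
  by (auto simp: cspan_def intro!: csubspace_sum)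

lemma cspan_superset: "S \<subseteq> cspan S"
proof
  fix f assume "f \<in> S"
  then show "f \<in> cspan S"
    unfolding cspan_def by (auto intro!: exI[of _ "{f}"] exI[of _ "\<lambda>_. 1"])
qed

lemma csubspace_L2: "csubspace (L2 p)"
  unfolding csubspace_def by auto

lemma cspan_subset_L2: "S \<subseteq> L2 p \<Longrightarrow> cspan S \<subseteq> L2 p"
  by (rule cspan_minimal[OF csubspace_L2])

text \<open>Reduces an inclusion between closed spans to generators, since a closed span is again a
  closed subspace.\<close>

lemma l2_closure_cspan_minimal:
  assumes S: "S \<subseteq> L2 p" and T: "T \<subseteq> l2_closure p (cspan S)"
  shows "l2_closure p (cspan T) \<subseteq> l2_closure p (cspan S)"
proof -
  have "cspan T \<subseteq> l2_closure p (cspan S)"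
    using S by (intro cspan_minimal T csubspace_l2_closure cspan_subset_L2 csubspace_cspan)
  then have "l2_closure p (cspan T) \<subseteq> l2_closure p (l2_closure p (cspan S))"
    by (rule l2_closure_mono)
  then show ?thesis using l2_closure_idem[OF cspan_subset_L2[OF S]] by simp
qed

text \<open>Functions are defined on all digit functions, but integrals only see
  \<open>Qp p\<close>, so values elsewhere may be altered freely.\<close>

lemma l2_closure_cong:
  assumes "f \<in> l2_closure p S" "\<And>x. x \<in> Qp p \<Longrightarrow> f x = g x"
  shows "g \<in> l2_closure p S"
proof -
  have "l2sq (\<lambda>x. f x - h x) = l2sq (\<lambda>x. g x - h x)" for h
    by (rule l2sq_cong) (use assms(2) in auto)
  then show ?thesis using assms L2_cong[of f g] by (auto simp: l2_closure_iff)
qed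

lemma L2_indicator:
  assumes "A \<in> sets (haar p)" "emeasure (haar p) A < \<infinity>"
  shows "indicator A \<in> L2 p"
proof -
  have "(cmod (indicator A x))\<^sup>2 = indicator A x" for x
    by (auto simp: indicator_def)
  then show ?thesis
    using assms sets.Int_space_eq2[OF assms(1)]
    by (auto simp: L2_def integrable_indicator_iff less_top)
qed

lemma l2sq_indicator: "A \<in> sets (haar p) \<Longrightarrow> l2sq (indicator A) = measure (haar p) A"
proof -
  assume A: "A \<in> sets (haar p)"
  have "(cmod (indicator A x))\<^sup>2 = indicator A x" for x
    by (auto simp: indicator_def)
  then have "l2sq (indicator A) = measure (haar p) (A \<inter> space (haar p))"
    unfolding l2sq_def by (simp del: space_haar)
  then show ?thesis using sets.Int_space_eq2[OF A] by simp
qed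

lemma L2_indicator_qball: "b \<in> Qp p \<Longrightarrow> indicator (qball j b) \<in> L2 p"
  by (rule L2_indicator) (auto simp: emeasure_qball)


section \<open>The Haar multiresolution analysis\<close>

lemma qp_ppow_in_Qp [simp]: "qp_ppow m x \<in> Qp p \<longleftrightarrow> x \<in> Qp p"
proof -
  have *: "qp_ppow m x \<in> Qp p" if "x \<in> Qp p" for m and x :: qp
  proof -
    from that obtain N where N: "\<forall>k<N. x k = 0" "\<forall>k. x k < p" by (auto simp: Qp_def)
    then have "\<forall>k<N + m. qp_ppow m x k = 0" "\<forall>k. qp_ppow m x k < p" by (auto simp: qp_ppow_def)
    then show ?thesis by (auto simp: Qp_def)
  qed
  have "qp_ppow (-m) (qp_ppow m x) = x" by (simp add: qp_ppow_def)
  then show ?thesis using *[of x m] *[of "qp_ppow m x" "-m"] by auto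
qed

lemma qp_ppow_ppow [simp]: "qp_ppow m (qp_ppow m' x) = qp_ppow (m + m') x"
  by (simp add: qp_ppow_def algebra_simps)

lemma qp_ppow_0 [simp]: "qp_ppow 0 x = x"
  by (simp add: qp_ppow_def)

text \<open>The Monna map reverses the order of digits, so multiplication by \<open>p^m\<close>
  becomes scaling by \<open>p^(-m)\<close> on the half-line.\<close>

lemma qp_ppow_monna_inv: "qp_ppow m (monna_inv p t) = monna_inv p (real p powr (- real_of_int m) * t)"
proof -
  have "t * real p powr real_of_int (k - m + 1) = real p powr (- real_of_int m) * t * real p powr real_of_int (k + 1)" for k
    by (simp add: powr_add[symmetric] algebra_simps)
  then show ?thesis unfolding qp_ppow_def monna_inv_def by presburger
qed

lemma measurable_qp_ppow [measurable]: "qp_ppow m \<in> measurable (haar p) (haar p)"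
proof -
  have "qp_ppow m \<in> measurable (haar p) (qp_sets p)"
    unfolding qp_sets_def
  proof (rule measurable_measure_of[OF qp_cylinders_Pow])
    show "qp_ppow m \<in> space (haar p) \<rightarrow> Qp p" by auto
    fix y assume "y \<in> {{x \<in> Qp p. x k = c} |k c. True}"
    then obtain k c where y: "y = {x \<in> Qp p. x k = c}" by auto
    have "qp_ppow m -` y \<inter> space (haar p) = {x \<in> Qp p. x (k - m) = c}"
      unfolding y by auto (simp_all add: qp_ppow_def)
    then show "qp_ppow m -` y \<inter> space (haar p) \<in> sets (haar p)"
      using digit_measurable by simp
  qed
  then show ?thesis by (subst measurable_cong_sets[OF refl sets_haar])
qed

lemma borel_measurable_haar_iff: "f \<in> borel_measurable (haar p) \<longleftrightarrow> f \<in> borel_measurable (qp_sets p)"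
  by (intro arg_cong[where f = "\<lambda>S. f \<in> S"] measurable_cong_sets sets_haar refl)

lemma haar_integrable_iff:
  fixes h :: "qp \<Rightarrow> real"
  assumes "h \<in> borel_measurable (haar p)"
  shows "integrable (haar p) h \<longleftrightarrow> integrable lborel (\<lambda>t. indicator {0..} t * h (monna_inv p t))"
  using assms unfolding borel_measurable_haar_iff haar_def
  by (subst integrable_distr_eq) (auto simp: integrable_restrict_space)

lemma haar_integral_eq:
  fixes h :: "qp \<Rightarrow> real"
  assumes "h \<in> borel_measurable (haar p)"
  shows "integral\<^sup>L (haar p) h = (LINT t|lborel. indicator {0..} t * h (monna_inv p t))"
  using assms unfolding borel_measurable_haar_iff haar_def
  by (subst integral_distr) (auto simp: integral_restrict_space)

text \<open>Pulled back along \<open>monna_inv\<close>, this is the substitution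
  \<open>t \<mapsto> c * t\<close> for Lebesgue measure.\<close>

lemma haar_dilation:
  fixes h :: "qp \<Rightarrow> real"
  assumes [measurable]: "h \<in> borel_measurable (haar p)"
  shows "integrable (haar p) (\<lambda>x. h (qp_ppow m x)) \<longleftrightarrow> integrable (haar p) h"
    and "(LINT x|haar p. h (qp_ppow m x)) = real p powr real_of_int m * integral\<^sup>L (haar p) h"
proof -
  define c where "c = real p powr (- real_of_int m)"
  have c: "0 < c" by (simp add: c_def)
  have meas: "(\<lambda>x. h (qp_ppow m x)) \<in> borel_measurable (haar p)" by measurable
  define F where "F = (\<lambda>t. indicator {0..} t * h (monna_inv p t))"
  \<comment> \<open>The half-line is invariant under scaling by \<open>c > 0\<close>; the summand 0
    fits the affine substitution rule.\<close>
  have F: "indicator {0..} t * h (qp_ppow m (monna_inv p t)) = F (0 + c * t)" for t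
    using c by (auto simp: F_def qp_ppow_monna_inv c_def[symmetric] indicator_def zero_le_mult_iff)
  show "integrable (haar p) (\<lambda>x. h (qp_ppow m x)) \<longleftrightarrow> integrable (haar p) h"
    unfolding haar_integrable_iff[OF meas] haar_integrable_iff[OF assms] F
    using lborel_integrable_real_affine_iff[of c F 0] c by (simp add: F_def[symmetric])
  have "(LINT t|lborel. F t) = c * (LINT t|lborel. F (0 + c * t))"
    using lborel_integral_real_affine[of c F 0] c by simp
  then show "(LINT x|haar p. h (qp_ppow m x)) = real p powr real_of_int m * integral\<^sup>L (haar p) h"
    unfolding haar_integral_eq[OF meas] haar_integral_eq[OF assms] F
    by (simp add: F_def[symmetric] c_def powr_minus)
qed

lemma L2_dilation: "f \<in> L2 p \<Longrightarrow> (\<lambda>x. f (qp_ppow m x)) \<in> L2 p"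
  using haar_dilation(1)[of "\<lambda>x. (cmod (f x))\<^sup>2" m] by (auto simp: L2_def)

lemma l2sq_dilation:
  "f \<in> borel_measurable (haar p) \<Longrightarrow>
    l2sq (\<lambda>x. f (qp_ppow m x)) = real p powr real_of_int m * l2sq f"
  unfolding l2sq_def by (rule haar_dilation(2)) simp

section \<open>The spaces of the Haar multiresolution analysis\<close>

definition ball_indicators :: "int \<Rightarrow> (qp \<Rightarrow> complex) set" where
  "ball_indicators j = {indicator (qball j b) | b. b \<in> Qp p}"

definition haar_space :: "int \<Rightarrow> (qp \<Rightarrow> complex) set" where
  "haar_space j = l2_closure p (cspan (ball_indicators j))"

lemma ball_indicators_subset_L2: "ball_indicators j \<subseteq> L2 p"
  by (auto simp: ball_indicators_def intro: L2_indicator_qball)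

lemma cspan_ball_indicators_subset_L2: "cspan (ball_indicators j) \<subseteq> L2 p"
  by (intro cspan_subset_L2 ball_indicators_subset_L2)

lemma haar_space_subset_L2: "haar_space j \<subseteq> L2 p"
  unfolding haar_space_def by (rule l2_closure_subset_L2)

lemma csubspace_haar_space: "csubspace (haar_space j)"
  unfolding haar_space_def
  by (intro csubspace_l2_closure cspan_ball_indicators_subset_L2 csubspace_cspan)

lemma l2_closure_haar_space: "l2_closure p (haar_space j) = haar_space j"
  unfolding haar_space_def by (intro l2_closure_idem cspan_ball_indicators_subset_L2)

lemma indicator_qball_in_haar_space: "b \<in> Qp p \<Longrightarrow> indicator (qball j b) \<in> haar_space j"
  unfolding haar_space_def
  using l2_closure_superset[OF cspan_ball_indicators_subset_L2] cspan_superset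
  by (fastforce simp: ball_indicators_def)

lemma fun_upd_in_Qp:
  assumes "b \<in> Qp p" "c < p"
  shows "b(j := c) \<in> Qp p"
proof -
  from assms(1) obtain N where "\<forall>k<N. b k = 0" "\<forall>k. b k < p" by (auto simp: Qp_def)
  then have "\<forall>k<min N j. (b(j := c)) k = 0" "\<forall>k. (b(j := c)) k < p" using assms(2) by auto
  then show ?thesis unfolding Qp_def by blast
qed

text \<open>The digit at position \<open>j\<close> splits a ball into \<open>p\<close> balls of the
  next level; this yields the inclusion of consecutive spaces.\<close>

lemma indicator_qball_split:
  assumes "b \<in> Qp p"
  shows "(indicator (qball j b) x :: complex) = (\<Sum>c<p. indicator (qball (j + 1) (b(j := c))) x)"
proof (cases "x \<in> qball j b")
  case True
  then have "x j < p" by (auto simp: qball_def Qp_def)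
  have "x \<in> qball (j + 1) (b(j := c)) \<longleftrightarrow> c = x j" for c
    using True by (auto simp: qball_def)
  then have "(\<Sum>c<p. indicator (qball (j + 1) (b(j := c))) x) = (\<Sum>c<p. if c = x j then 1 else (0::complex))"
    by (intro sum.cong) (auto simp: indicator_def)
  then show ?thesis using True \<open>x j < p\<close> by simp
next
  case False
  then have "x \<notin> qball (j + 1) (b(j := c))" for c
    by (auto simp: qball_def)
  then show ?thesis using False by simp
qed

lemma haar_space_Suc: "haar_space j \<subseteq> haar_space (j + 1)"
proof -
  have "ball_indicators j \<subseteq> haar_space (j + 1)"
  proof
    fix f assume "f \<in> ball_indicators j"
    then obtain b where b: "b \<in> Qp p" and f: "f = indicator (qball j b)"
      by (auto simp: ball_indicators_def)
    have "(\<lambda>x. \<Sum>c<p. 1 * indicator (qball (j + 1) (b(j := c))) x) \<in> haar_space (j + 1)"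
      by (intro csubspace_sum csubspace_haar_space indicator_qball_in_haar_space fun_upd_in_Qp b) auto
    then show "f \<in> haar_space (j + 1)"
      unfolding f by (simp flip: indicator_qball_split[OF b])
  qed
  then show ?thesis
    unfolding haar_space_def by (intro l2_closure_cspan_minimal ball_indicators_subset_L2)
qed

lemma haar_space_mono: "i \<le> j \<Longrightarrow> haar_space i \<subseteq> haar_space j"
  by (induction j rule: int_ge_induct) (use haar_space_Suc in auto)

lemma indicator_qball_dilation:
  "indicator (qball j b) (qp_ppow m x) = indicator (qball (j - m) (qp_ppow (- m) b)) x"
proof -
  have "(\<forall>k<j. x (k - m) = b k) \<longleftrightarrow> (\<forall>k<j - m. x k = b (k + m))"
    by (metis add_diff_cancel diff_add_cancel diff_strict_right_mono less_diff_eq)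
  then have "qp_ppow m x \<in> qball j b \<longleftrightarrow> x \<in> qball (j - m) (qp_ppow (- m) b)"
    by (simp add: qball_def) (simp add: qp_ppow_def)
  then show ?thesis by (simp add: indicator_def)
qed

text \<open>Dilation sends indicators of balls to indicators of balls and multiplies all squared
  distances by the same factor, so it respects closed spans.\<close>

lemma haar_space_dilation:
  assumes "f \<in> haar_space j"
  shows "(\<lambda>x. f (qp_ppow m x)) \<in> haar_space (j - m)"
proof -
  have fL: "f \<in> L2 p" using assms haar_space_subset_L2 by auto
  have span: "(\<lambda>x. g (qp_ppow m x)) \<in> cspan (ball_indicators (j - m))"
    if "g \<in> cspan (ball_indicators j)" for g
  proof -
    from that obtain F c where F: "F \<subseteq> ball_indicators j" "g = (\<lambda>x. \<Sum>h\<in>F. c h * h x)"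
      by (auto simp: cspan_def)
    have "(\<lambda>x. h (qp_ppow m x)) \<in> cspan (ball_indicators (j - m))" if "h \<in> F" for h
    proof -
      from that F obtain b where b: "b \<in> Qp p" "h = indicator (qball j b)"
        by (auto simp: ball_indicators_def)
      then have "(\<lambda>x. h (qp_ppow m x)) = indicator (qball (j - m) (qp_ppow (- m) b))"
        by (simp add: indicator_qball_dilation)
      then show ?thesis using b cspan_superset by (fastforce simp: ball_indicators_def)
    qed
    then show ?thesis unfolding F(2) by (intro csubspace_sum csubspace_cspan)
  qed
  have "\<exists>g\<in>cspan (ball_indicators (j - m)). l2sq (\<lambda>x. f (qp_ppow m x) - g x) < e" if e: "0 < e" for e
  proof -
    have pos: "0 < real p powr real_of_int m" by simp
    with e obtain g where g: "g \<in> cspan (ball_indicators j)"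
      "l2sq (\<lambda>x. f x - g x) < e / real p powr real_of_int m"
      using assms unfolding haar_space_def l2_closure_iff by (meson divide_pos_pos)
    have gL: "g \<in> L2 p" using g cspan_ball_indicators_subset_L2 by auto
    have "l2sq (\<lambda>x. f (qp_ppow m x) - g (qp_ppow m x)) =
      real p powr real_of_int m * l2sq (\<lambda>x. f x - g x)"
      using l2sq_dilation[OF L2_measurable[OF L2_diff[OF fL gL]], of m] by simp
    also have "\<dots> < e" using g(2) pos by (simp add: field_simps)
    finally show ?thesis using span[OF g(1)] by (intro bexI)
  qed
  then show ?thesis
    unfolding haar_space_def l2_closure_iff using L2_dilation[OF fL] by auto
qed

lemma haar_space_dilation_iff:
  "f \<in> haar_space j \<longleftrightarrow> (\<lambda>x. f (qp_ppow (-1) x)) \<in> haar_space (j + 1)"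
  using haar_space_dilation[of f j "-1"] haar_space_dilation[of "\<lambda>x. f (qp_ppow (-1) x)" "j + 1" 1]
  by auto

section \<open>Trivial intersection\<close>

lemma cspan_ball_indicators_const:
  assumes "g \<in> cspan (ball_indicators j)" "x \<in> Qp p" "y \<in> Qp p" "\<forall>k<j. x k = y k"
  shows "g x = g y"
proof -
  from assms(1) obtain F c where F: "F \<subseteq> ball_indicators j" "g = (\<lambda>x. \<Sum>h\<in>F. c h * h x)"
    by (auto simp: cspan_def)
  have "h x = h y" if "h \<in> F" for h
    using that F assms by (auto simp: ball_indicators_def qball_def indicator_def)
  then show ?thesis unfolding F(2) by (intro sum.cong) auto
qed

lemma L2_mult_indicator:
  assumes f: "f \<in> L2 p" and A: "A \<in> sets (haar p)"
  shows "(\<lambda>x. indicator A x * f x) \<in> L2 p"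
proof -
  note [measurable] = L2_measurable[OF f] A
  have "integrable (haar p) (\<lambda>x. (cmod (indicator A x * f x))\<^sup>2)"
    by (rule Bochner_Integration.integrable_bound[OF L2_integrable[OF f]])
      (auto simp: indicator_def)
  then show ?thesis by (simp add: L2_def)
qed

lemma l2sq_mult_indicator_le:
  assumes f: "f \<in> L2 p" and A: "A \<in> sets (haar p)"
  shows "l2sq (\<lambda>x. indicator A x * f x) \<le> l2sq f"
  by (rule l2sq_mono) (use L2_mult_indicator assms in \<open>auto simp: indicator_def\<close>)

lemma l2sq_disc: "l2sq (indicator (disc N)) = real p ^ N"
proof -
  have "l2sq (indicator (disc N)) = measure (haar p) (disc N)"
    unfolding disc_eq_qball by (intro l2sq_indicator) simp
  also have "\<dots> = real p ^ N"
    using measure_qball[OF zero_in_Qp, of "- int N"] by (simp add: disc_eq_qball powr_realpow)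
  finally show ?thesis .
qed

lemma disc_sets [measurable, simp]: "disc N \<in> sets (haar p)"
  by (simp add: disc_eq_qball)

text \<open>An approximant \<open>g\<close> is constant on the large disc
  \<open>disc (N + n)\<close>, and its norm bounds that constant. The smaller disc has only the
  fraction \<open>1 / p^n\<close> of the measure, so little of \<open>g\<close>, and hence of
  \<open>f\<close>, lives on it.\<close>

lemma haar_space_bound:
  assumes f: "f \<in> haar_space (- int (N + n))" and e: "0 < e" "e \<le> 1"
  shows "l2sq (\<lambda>x. indicator (disc N) x * f x) \<le> 2 * e + (4 * l2sq f + 4) / real p ^ n"
proof -
  obtain g where g: "g \<in> cspan (ball_indicators (- int (N + n)))" "l2sq (\<lambda>x. f x - g x) < e"
    using f e unfolding haar_space_def l2_closure_iff by blast
  have fL: "f \<in> L2 p" and gL: "g \<in> L2 p"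
    using f g cspan_ball_indicators_subset_L2 haar_space_subset_L2 by auto
  have g_const: "g x = g qp_zero" if "x \<in> disc (N + n)" for x
    by (rule cspan_ball_indicators_const[OF g(1)]) (use that in \<open>auto simp: disc_def qp_zero_def zero_in_Qp[unfolded qp_zero_def]\<close>)
  have on_disc: "l2sq (\<lambda>x. indicator (disc M) x * g x) = (cmod (g qp_zero))\<^sup>2 * real p ^ M" if "M \<le> N + n" for M
  proof -
    have "(\<lambda>x. indicator (disc M) x * g x) = (\<lambda>x. g qp_zero * indicator (disc M) x)"
      using g_const disc_mono[OF that] by (auto simp: indicator_def fun_eq_iff)
    then show ?thesis by (simp add: l2sq_cmult l2sq_disc)
  qed
  have "(cmod (g qp_zero))\<^sup>2 * real p ^ (N + n) \<le> l2sq g"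
    using on_disc[of "N + n"] l2sq_mult_indicator_le[OF gL disc_sets, of "N + n"] by simp
  also have "\<dots> = l2sq (\<lambda>x. f x + (-1) * (f x - g x))" by simp
  also have "\<dots> \<le> 2 * l2sq f + 2 * l2sq (\<lambda>x. (-1) * (f x - g x))"
    using fL gL by (intro l2sq_add_le L2_cmult L2_diff)
  \<comment> \<open>The hypothesis \<open>e \<le> 1\<close> bounds the approximation error
    here.\<close>
  also have "\<dots> \<le> 2 * l2sq f + 2" using g e unfolding l2sq_cmult by simp
  finally have c: "(cmod (g qp_zero))\<^sup>2 * real p ^ N \<le> (2 * l2sq f + 2) / real p ^ n"
    by (simp add: power_add field_simps)
  have "l2sq (\<lambda>x. indicator (disc N) x * f x) =
      l2sq (\<lambda>x. indicator (disc N) x * (f x - g x) + indicator (disc N) x * g x)"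
    by (simp add: algebra_simps)
  also have "\<dots> \<le> 2 * l2sq (\<lambda>x. indicator (disc N) x * (f x - g x)) + 2 * l2sq (\<lambda>x. indicator (disc N) x * g x)"
    using fL gL by (intro l2sq_add_le L2_mult_indicator L2_diff) auto
  also have "\<dots> \<le> 2 * e + 2 * ((2 * l2sq f + 2) / real p ^ n)"
    unfolding on_disc[of N, simplified]
    using c g(2) l2sq_mult_indicator_le[OF L2_diff[OF fL gL] disc_sets, of N]
    by (intro add_mono mult_left_mono) auto
  finally show ?thesis by (simp add: field_simps)
qed

lemma l2sq_eq_0_iff:
  assumes "f \<in> L2 p"
  shows "l2sq f = 0 \<longleftrightarrow> (AE x in haar p. f x = 0)"
  unfolding l2sq_def using L2_integrable[OF assms]
  by (subst integral_nonneg_eq_0_iff_AE) auto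

lemma haar_space_Inter:
  assumes "\<forall>j. f \<in> haar_space j"
  shows "l2norm p f = 0"
proof -
  have fL: "f \<in> L2 p" using assms haar_space_subset_L2 by auto
  have "l2sq (\<lambda>x. indicator (disc N) x * f x) = 0" for N
  proof -
    have "l2sq (\<lambda>x. indicator (disc N) x * f x) \<le> 0 + d" if "0 < d" for d
    proof -
      \<comment> \<open>With \<open>min 1 (d / 4)\<close> in the role of \<open>e\<close>, both
        terms of the bound are at most \<open>d / 2\<close>.\<close>
      obtain n where n: "(4 * l2sq f + 4) / (d / 2) < real p ^ n"
        using real_arch_pow[of "real p"] p_gt_1 by auto
      then have "(4 * l2sq f + 4) / real p ^ n \<le> d / 2"
        using \<open>0 < d\<close> by (simp add: field_simps)
      moreover have "l2sq (\<lambda>x. indicator (disc N) x * f x) \<le> 2 * min 1 (d / 4) + (4 * l2sq f + 4) / real p ^ n"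
        using assms \<open>0 < d\<close> by (intro haar_space_bound) auto
      ultimately show ?thesis by linarith
    qed
    then have "l2sq (\<lambda>x. indicator (disc N) x * f x) \<le> 0" by (rule field_le_epsilon)
    then show ?thesis using l2sq_nonneg by (simp add: order_antisym)
  qed
  then have "AE x in haar p. indicator (disc N) x * f x = 0" for N
    using l2sq_eq_0_iff[OF L2_mult_indicator[OF fL disc_sets]] by blast
  then have "AE x in haar p. \<forall>N. indicator (disc N) x * f x = 0"
    by (simp only: AE_all_countable simp_thms)
  moreover have "f x = 0" if x: "x \<in> Qp p" and z: "\<forall>N. indicator (disc N) x * f x = 0" for x
  proof -
    obtain N where "x \<in> disc N" using x by (rule Qp_ex_disc)
    then show ?thesis using z[rule_format, of N] by simp
  qed
  ultimately have "AE x in haar p. f x = 0" by (auto elim!: AE_mp)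
  then show ?thesis using l2sq_eq_0_iff[OF fL] by (simp add: l2norm_conv)
qed


section \<open>Density of the union\<close>

lemma qball_countable_cover:
  "\<exists>C. countable C \<and> C \<subseteq> Qp p \<and> (\<forall>x\<in>Qp p. \<exists>b\<in>C. x \<in> qball j b)"
proof (intro exI conjI ballI)
  let ?C = "(\<lambda>i. monna_inv p (real_of_int i / real p powr real_of_int j)) ` {0..}"
  show "countable ?C" by simp
  show "?C \<subseteq> Qp p" by (auto intro!: monna_inv_in_Qp)
  fix x assume x: "x \<in> Qp p"
  obtain i where "0 \<le> i" "\<forall>k<j. monna_inv p (real_of_int i / real p powr real_of_int j) k = x k"
    using ex_monna_inv_agree[OF x] by blast
  then show "\<exists>b\<in>?C. x \<in> qball j b" using x by (force simp: qball_def)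
qed

text \<open>The empty set is added to make the system closed under intersection.\<close>

definition ball_system :: "qp set set" where
  "ball_system = insert {} {qball j b | j b. b \<in> Qp p}"

lemma ball_system_Pow: "ball_system \<subseteq> Pow (Qp p)"
  by (auto simp: ball_system_def qball_def)

text \<open>The ultrametric property: two balls are nested or disjoint.\<close>

lemma qball_Int_in_ball_system:
  assumes "b \<in> Qp p" "b' \<in> Qp p" "j \<le> j'"
  shows "qball j b \<inter> qball j' b' \<in> ball_system"
proof (cases "\<forall>k<j. b k = b' k")
  case True
  then have "qball j b \<inter> qball j' b' = qball j' b'" using assms(3) by (auto simp: qball_def)
  then show ?thesis using assms by (auto simp: ball_system_def)
next
  case False
  then have "qball j b \<inter> qball j' b' = {}" using assms(3) by (force simp: qball_def)
  then show ?thesis by (simp add: ball_system_def)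
qed

lemma Int_stable_ball_system: "Int_stable ball_system"
proof (rule Int_stableI)
  fix A B assume A: "A \<in> ball_system" and B: "B \<in> ball_system"
  show "A \<inter> B \<in> ball_system"
  proof (cases "A = {} \<or> B = {}")
    case True
    then show ?thesis by (auto simp: ball_system_def)
  next
    case False
    then obtain j b j' b' where *: "A = qball j b" "B = qball j' b'" "b \<in> Qp p" "b' \<in> Qp p"
      using A B by (auto simp: ball_system_def)
    then show ?thesis
      using qball_Int_in_ball_system[of b b' j j'] qball_Int_in_ball_system[of b' b j' j]
      by (cases "j \<le> j'") (auto simp: Int_commute)
  qed
qed

text \<open>A digit cylinder is a union of balls of level \<open>k + 1\<close>, and countably many
  centres suffice.\<close>

lemma sets_haar_ball_system: "sets (haar p) = sigma_sets (Qp p) ball_system"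
proof
  have "ball_system \<subseteq> sets (haar p)" by (auto simp: ball_system_def)
  then show "sigma_sets (Qp p) ball_system \<subseteq> sets (haar p)"
    using sets.sigma_sets_subset[of ball_system "haar p"] by simp
  show "sets (haar p) \<subseteq> sigma_sets (Qp p) ball_system"
    unfolding sets_haar sets_qp_sets
  proof (rule sigma_sets_mono, safe)
    fix k c
    obtain C where C: "countable C" "C \<subseteq> Qp p" "\<forall>x\<in>Qp p. \<exists>b\<in>C. x \<in> qball (k + 1) b"
      using qball_countable_cover[of "k + 1"] by blast
    have "{x \<in> Qp p. x k = c} = (\<Union>b\<in>{b \<in> C. b k = c}. qball (k + 1) b)"
    proof (intro equalityI subsetI)
      fix x assume x: "x \<in> {x \<in> Qp p. x k = c}"
      then obtain b where "b \<in> C" "x \<in> qball (k + 1) b" using C by blast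
      then show "x \<in> (\<Union>b\<in>{b \<in> C. b k = c}. qball (k + 1) b)"
        using x by (auto simp: qball_def)
    qed (auto simp: qball_def)
    also have "\<dots> \<in> sigma_sets (Qp p) ball_system"
    proof (rule sigma_sets_UNION)
      show "countable ((\<lambda>b. qball (k + 1) b) ` {b \<in> C. b k = c})"
        using C(1) by simp
      show "B \<in> sigma_sets (Qp p) ball_system"
        if "B \<in> (\<lambda>b. qball (k + 1) b) ` {b \<in> C. b k = c}" for B
        using that C(2) by (auto simp: ball_system_def intro!: sigma_sets.Basic)
    qed
    finally show "{x \<in> Qp p. x k = c} \<in> sigma_sets (Qp p) ball_system" .
  qed
qed

definition haar_limit :: "(qp \<Rightarrow> complex) set" where
  "haar_limit = l2_closure p (\<Union>j. haar_space j)"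

lemma Union_haar_space_subset_L2: "(\<Union>j. haar_space j) \<subseteq> L2 p"
  using haar_space_subset_L2 by auto

lemma csubspace_Union_haar_space: "csubspace (\<Union>j. haar_space j)"
  unfolding csubspace_def
proof (intro conjI ballI allI)
  show "(\<lambda>x. 0) \<in> (\<Union>j. haar_space j)"
    using csubspace_haar_space[of 0] by (auto simp: csubspace_def)
next
  fix f g assume "f \<in> (\<Union>j. haar_space j)" "g \<in> (\<Union>j. haar_space j)"
  then obtain i j where "f \<in> haar_space i" "g \<in> haar_space j" by auto
  then have "f \<in> haar_space (max i j)" "g \<in> haar_space (max i j)"
    using haar_space_mono[of i "max i j"] haar_space_mono[of j "max i j"] by auto
  then show "(\<lambda>x. f x + g x) \<in> (\<Union>j. haar_space j)"
    using csubspace_haar_space[of "max i j"] by (auto simp: csubspace_def)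
next
  fix c f assume "f \<in> (\<Union>j. haar_space j)"
  then show "(\<lambda>x. c * f x) \<in> (\<Union>j. haar_space j)"
    using csubspace_haar_space by (fastforce simp: csubspace_def)
qed

lemma csubspace_haar_limit: "csubspace haar_limit"
  unfolding haar_limit_def
  by (intro csubspace_l2_closure Union_haar_space_subset_L2 csubspace_Union_haar_space)

lemma l2_closure_haar_limit: "l2_closure p haar_limit = haar_limit"
  unfolding haar_limit_def by (intro l2_closure_idem Union_haar_space_subset_L2)

lemma haar_limit_tendsto:
  assumes f: "f \<in> L2 p" and g: "\<And>n. g n \<in> haar_limit"
    and lim: "(\<lambda>n. l2sq (\<lambda>x. f x - g n x)) \<longlonglongrightarrow> 0"
  shows "f \<in> haar_limit"
proof -
  have "\<exists>h\<in>haar_limit. l2sq (\<lambda>x. f x - h x) < e" if "0 < e" for e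
  proof -
    have "\<forall>\<^sub>F n in sequentially. l2sq (\<lambda>x. f x - g n x) < e"
      using lim that by (rule order_tendstoD)
    then obtain n where "l2sq (\<lambda>x. f x - g n x) < e"
      by (auto simp: eventually_sequentially)
    then show ?thesis using g by blast
  qed
  then have "f \<in> l2_closure p haar_limit" using f by (simp add: l2_closure_iff)
  then show ?thesis by (simp add: l2_closure_haar_limit)
qed

lemma indicator_ball_system_in_haar_limit: "A \<in> ball_system \<Longrightarrow> indicator A \<in> haar_limit"
proof -
  assume "A \<in> ball_system"
  then consider "A = {}" | j b where "A = qball j b" "b \<in> Qp p" by (auto simp: ball_system_def)
  then show ?thesis
  proof cases
    case 1
    moreover have "indicator {} = (\<lambda>x :: qp. 0 :: complex)" by (simp add: fun_eq_iff)
    ultimately show ?thesis using csubspaceD(1)[OF csubspace_haar_limit] by simp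
  next
    case 2
    then show ?thesis
      using indicator_qball_in_haar_space l2_closure_superset[OF Union_haar_space_subset_L2]
      unfolding haar_limit_def by blast
  qed
qed

lemma emeasure_disc_finite: "emeasure (haar p) (disc N) < \<infinity>"
  by (simp add: disc_eq_qball emeasure_qball zero_in_Qp)

lemma emeasure_Int_disc_finite:
  assumes "A \<in> sets (haar p)"
  shows "emeasure (haar p) (A \<inter> disc N) < \<infinity>"
  using emeasure_mono[of "A \<inter> disc N" "disc N" "haar p"] emeasure_disc_finite[of N]
  by (auto intro: order.strict_trans1)

lemma disc_in_ball_system: "disc N \<in> ball_system"
  using zero_in_Qp by (auto simp: ball_system_def disc_eq_qball)

text \<open>A Dynkin argument over the intersection-stable system of balls. Cutting by a disc keeps
  all measures finite, so complements and countable disjoint unions stay in L2.\<close>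

lemma indicator_Int_disc_in_haar_limit:
  assumes "A \<in> sets (haar p)"
  shows "indicator (A \<inter> disc N) \<in> haar_limit"
  using Int_stable_ball_system ball_system_Pow assms[unfolded sets_haar_ball_system]
proof (induction rule: sigma_sets_induct_disjoint)
  case (basic A)
  then have "A \<inter> disc N \<in> ball_system"
    using Int_stable_ball_system disc_in_ball_system by (auto simp: Int_stable_def)
  then show ?case by (rule indicator_ball_system_in_haar_limit)
next
  case empty
  have "indicator ({} \<inter> disc N) = (\<lambda>x. 0 :: complex)" by (simp add: fun_eq_iff)
  then show ?case using csubspaceD(1)[OF csubspace_haar_limit] by simp
next
  case (compl A)
  have "(\<lambda>x. (-1) * indicator (A \<inter> disc N) x :: complex) \<in> haar_limit"
    by (intro csubspaceD(3)[OF csubspace_haar_limit] compl.IH)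
  then have "(\<lambda>x. indicator (disc N) x + (-1) * indicator (A \<inter> disc N) x) \<in> haar_limit"
    by (intro csubspaceD(2)[OF csubspace_haar_limit] indicator_ball_system_in_haar_limit[OF disc_in_ball_system])
  moreover have "indicator ((Qp p - A) \<inter> disc N) = (\<lambda>x. indicator (disc N) x + (-1) * (indicator (A \<inter> disc N) x :: complex))"
    using disc_subset_Qp by (auto simp: indicator_def fun_eq_iff)
  ultimately show ?case by simp
next
  case (union A)
  have A: "A i \<in> sets (haar p)" for i using union by (auto simp: sets_haar_ball_system)
  define U where "U = (\<Union>i. A i) \<inter> disc N"
  define P where "P = (\<lambda>n. (\<Union>i<n. A i) \<inter> disc N)"
  have U: "U \<in> sets (haar p)" and P: "P n \<in> sets (haar p)" for n
    using A by (auto simp: U_def P_def)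
  have fin: "emeasure (haar p) U < \<infinity>" "emeasure (haar p) (P n) < \<infinity>" for n
    unfolding U_def P_def by (intro emeasure_Int_disc_finite; use A in auto)+
  have "indicator U \<in> haar_limit"
  proof (rule haar_limit_tendsto)
    show "indicator U \<in> L2 p" using U fin(1) by (rule L2_indicator)
    show "indicator (P n) \<in> haar_limit" for n
    proof -
      have "indicator (P n) x = (\<Sum>i<n. 1 * (indicator (A i \<inter> disc N) x :: complex))" for x
      proof -
        have "indicator (P n) x = (indicator (\<Union>i<n. A i \<inter> disc N) x :: complex)"
          by (auto simp: P_def indicator_def)
        also have "\<dots> = (\<Sum>i<n. indicator (A i \<inter> disc N) x)"
          using union(1) by (intro indicator_UN_disjoint) (auto simp: disjoint_family_on_def)
        finally show ?thesis by simp
      qed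
      moreover have "(\<lambda>x. \<Sum>i<n. 1 * (indicator (A i \<inter> disc N) x :: complex)) \<in> haar_limit"
        using union by (intro csubspace_sum csubspace_haar_limit) auto
      ultimately show ?thesis by presburger
    qed
    \<comment> \<open>The squared distance of nested indicators is the difference of the measures,
      which tends to 0 along the increasing partial unions.\<close>
    have "l2sq (\<lambda>x. indicator U x - indicator (P n) x) = measure (haar p) U - measure (haar p) (P n)" for n
    proof -
      have sub: "P n \<subseteq> U" by (auto simp: P_def U_def)
      then have "(\<lambda>x. indicator U x - indicator (P n) x :: complex) = indicator (U - P n)"
        by (auto simp: indicator_def fun_eq_iff)
      then have "l2sq (\<lambda>x. indicator U x - indicator (P n) x) = measure (haar p) (U - P n)"
        using U P by (simp add: l2sq_indicator)
      also have "\<dots> = measure (haar p) U - measure (haar p) (P n)"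
        using U P fin sub by (intro measure_Diff) auto
      finally show ?thesis .
    qed
    moreover have "(\<lambda>n. measure (haar p) (P n)) \<longlonglongrightarrow> measure (haar p) (\<Union>n. P n)"
    proof (rule Lim_measure_incseq)
      show "incseq P" by (force simp: P_def incseq_def)
      have "(\<Union>n. P n) \<subseteq> U" by (auto simp: P_def U_def)
      then show "emeasure (haar p) (\<Union>n. P n) \<noteq> \<infinity>"
        using fin(1) U emeasure_mono[of "\<Union>n. P n" U "haar p"] by auto
    qed (use P in auto)
    moreover have "(\<Union>n. P n) = U" by (auto simp: P_def U_def)
    ultimately show "(\<lambda>n. l2sq (\<lambda>x. indicator U x - indicator (P n) x)) \<longlonglongrightarrow> 0"
      by (auto intro!: tendsto_eq_intros)
  qed
  then show ?case by (simp add: U_def)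
qed

text \<open>Simple functions converging to \<open>f\<close> are cut off to growing discs, so that
  their level sets have finite measure; dominated convergence then gives convergence in
  norm.\<close>

lemma haar_limit_eq_L2: "haar_limit = L2 p"
proof
  show "haar_limit \<subseteq> L2 p" unfolding haar_limit_def by (rule l2_closure_subset_L2)
  show "L2 p \<subseteq> haar_limit"
  proof
    fix f assume f: "f \<in> L2 p"
    note [measurable] = L2_measurable[OF f]
    obtain s where s: "\<And>i. simple_function (haar p) (s i)"
      "\<And>x. x \<in> space (haar p) \<Longrightarrow> (\<lambda>i. s i x) \<longlonglongrightarrow> f x"
      "\<And>i x. x \<in> space (haar p) \<Longrightarrow> dist (s i x) 0 \<le> 2 * dist (f x) 0"
      using borel_measurable_implies_sequence_metric[OF L2_measurable[OF f], of 0] by metis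
    note [measurable] = borel_measurable_simple_function[OF s(1)]
    define g where "g = (\<lambda>i x. indicator (disc i) x * s i x)"
    have [measurable]: "g i \<in> borel_measurable (haar p)" for i unfolding g_def by measurable
    have g_bound: "cmod (g i x) \<le> 2 * cmod (f x)" if "x \<in> Qp p" for i x
      using s(3)[of x i] that by (auto simp: g_def indicator_def)
    show "f \<in> haar_limit"
    proof (rule haar_limit_tendsto[OF f])
      fix n
      let ?R = "s n ` Qp p"
      have fin: "finite ?R" using s(1)[of n] by (simp add: simple_function_def)
      have level: "s n -` {y} \<inter> Qp p \<in> sets (haar p)" if "y \<in> ?R" for y
        using simple_functionD(2)[OF s(1)[of n], of "{y}"] by simp
      have "(\<lambda>x. \<Sum>y\<in>?R. y * indicator (s n -` {y} \<inter> Qp p \<inter> disc n) x) \<in> haar_limit"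
        using level by (intro csubspace_sum csubspace_haar_limit indicator_Int_disc_in_haar_limit)
      moreover have "g n x = (\<Sum>y\<in>?R. y * indicator (s n -` {y} \<inter> Qp p \<inter> disc n) x)" for x
      proof (cases "x \<in> disc n")
        case True
        then have x: "x \<in> Qp p" using disc_subset_Qp by auto
        have "(\<Sum>y\<in>?R. y * indicator (s n -` {y} \<inter> Qp p \<inter> disc n) x) = (\<Sum>y\<in>?R. if y = s n x then y else 0)"
          using True x by (intro sum.cong) (auto simp: indicator_def)
        then show ?thesis using fin True x by (simp add: g_def)
      qed (simp add: g_def)
      ultimately show "g n \<in> haar_limit" by presburger
    next
      have "(\<lambda>n. l2sq (\<lambda>x. f x - g n x)) \<longlonglongrightarrow> (LINT x|haar p. (cmod 0)\<^sup>2)"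
        unfolding l2sq_def
      proof (rule integral_dominated_convergence)
        \<comment> \<open>The factor is \<open>3^2\<close>: the cut-off functions are bounded by
          \<open>2 * cmod (f x)\<close>, so the difference is at most
          \<open>3 * cmod (f x)\<close>.\<close>
        show "integrable (haar p) (\<lambda>x. 9 * (cmod (f x))\<^sup>2)" using L2_integrable[OF f] by simp
        show "AE x in haar p. (\<lambda>n. (cmod (f x - g n x))\<^sup>2) \<longlonglongrightarrow> (cmod 0)\<^sup>2"
        proof (rule AE_I2)
          fix x assume x: "x \<in> space (haar p)"
          then obtain N where N: "x \<in> disc N" using Qp_eq_Union_disc by auto
          have "\<forall>\<^sub>F n in sequentially. s n x = g n x"
            using eventually_ge_at_top[of N] 
            by eventually_elim (use N disc_mono in \<open>auto simp: g_def subset_iff\<close>)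
          with s(2)[OF x] have "(\<lambda>n. g n x) \<longlonglongrightarrow> f x" by (rule Lim_transform_eventually)
          then have "(\<lambda>n. f x - g n x) \<longlonglongrightarrow> 0" by (auto intro!: tendsto_eq_intros)
          then show "(\<lambda>n. (cmod (f x - g n x))\<^sup>2) \<longlonglongrightarrow> (cmod 0)\<^sup>2"
            by (intro tendsto_intros)
        qed
        show "AE x in haar p. norm ((cmod (f x - g n x))\<^sup>2) \<le> 9 * (cmod (f x))\<^sup>2" for n
        proof (rule AE_I2)
          fix x assume "x \<in> space (haar p)"
          then have "cmod (f x - g n x) \<le> 3 * cmod (f x)"
            using g_bound[of x n] norm_triangle_ineq4[of "f x" "g n x"] by simp
          then have "(cmod (f x - g n x))\<^sup>2 \<le> (3 * cmod (f x))\<^sup>2" by (intro power_mono) auto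
          then show "norm ((cmod (f x - g n x))\<^sup>2) \<le> 9 * (cmod (f x))\<^sup>2"
            by (simp add: power_mult_distrib)
        qed
      qed measurable
      then show "(\<lambda>n. l2sq (\<lambda>x. f x - g n x)) \<longlonglongrightarrow> 0" by simp
    qed
  qed
qed


section \<open>Digits and subtraction\<close>

text \<open>On the disc \<open>p\<^sup>-\<^sup>N \<int>\<^sub>p\<close> the number \<open>residue N x m\<close> is the class of \<open>p\<^sup>N x\<close> modulo \<open>p\<^sup>m\<close>.\<close>
definition residue :: "nat \<Rightarrow> qp \<Rightarrow> nat \<Rightarrow> int" where
  "residue N x m = (\<Sum>j<m. int (x (int j - int N)) * int p ^ j)"

lemma residue_0 [simp]: "residue N x 0 = 0"
  by (simp add: residue_def)

lemma residue_Suc: "residue N x (Suc m) = residue N x m + int (x (int m - int N)) * int p ^ m"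
  by (simp add: residue_def)

lemma residue_bounds:
  assumes "x \<in> Qp p"
  shows "0 \<le> residue N x m" "residue N x m < int p ^ m"
proof -
  show "0 \<le> residue N x m" by (simp add: residue_def sum_nonneg)
  show "residue N x m < int p ^ m"
  proof (induction m)
    case (Suc m)
    have "x (int m - int N) < p" using assms by (auto simp: Qp_def)
    then have "int (x (int m - int N)) \<le> int p - 1" by simp
    then have "int (x (int m - int N)) * int p ^ m \<le> (int p - 1) * int p ^ m"
      by (intro mult_right_mono) auto
    then show ?case using Suc by (simp add: residue_Suc algebra_simps)
  qed simp
qed

lemma residue_mod:
  assumes "x \<in> Qp p" "m \<le> m'"
  shows "residue N x m' mod int p ^ m = residue N x m"
  using assms(2)
proof (induction m' rule: dec_induct)
  case base
  then show ?case using residue_bounds[OF assms(1)] by simp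
next
  case (step n)
  then have "int p ^ m dvd int (x (int n - int N)) * int p ^ n"
    by (simp add: le_imp_power_dvd)
  then show ?case using step unfolding residue_Suc
    by (metis mod_add_right_eq dvd_imp_mod_0 add.right_neutral)
qed

text \<open>Consecutive residues differ by one digit times a power of \<open>p\<close>, so equal
  residues force equal digits; below \<open>- int N\<close> both digits are zero.\<close>

lemma residue_eq_iff:
  assumes x: "x \<in> disc N" and y: "y \<in> disc N"
  shows "residue N x m = residue N y m \<longleftrightarrow> (\<forall>k<int m - int N. x k = y k)"
proof
  assume eq: "residue N x m = residue N y m"
  have xQ: "x \<in> Qp p" and yQ: "y \<in> Qp p" using x y disc_subset_Qp by auto
  have le: "residue N x i = residue N y i" if "i \<le> m" for i
    using residue_mod[OF xQ that] residue_mod[OF yQ that] eq by metis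
  show "\<forall>k<int m - int N. x k = y k"
  proof (intro allI impI)
    fix k assume k: "k < int m - int N"
    show "x k = y k"
    proof (cases "k < - int N")
      case True
      then show ?thesis using x y by (simp add: disc_def)
    next
      case False
      define i where "i = nat (k + int N)"
      have i: "int i - int N = k" "Suc i \<le> m" using k False by (auto simp: i_def)
      then have "int (x k) * int p ^ i = int (y k) * int p ^ i"
        using le[of "Suc i"] le[of i] by (simp add: residue_Suc)
      then show ?thesis by simp
    qed
  qed
qed (auto simp: residue_def)

lemma residue_zero [simp]: "residue N qp_zero m = 0"
  by (simp add: residue_def qp_zero_def)

lemma zero_in_disc [simp]: "qp_zero \<in> disc N"
  using zero_in_Qp by (simp add: disc_def qp_zero_def)

text \<open>The inverse limit description of the disc: the digits are read off from quotients of
  consecutive residues.\<close>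

lemma ex_residue_sequence:
  assumes "\<And>m. [r (Suc m) = r m] (mod int p ^ m)"
  shows "\<exists>z\<in>disc N. \<forall>m. residue N z m = r m mod int p ^ m"
proof -
  define d where "d = (\<lambda>j. nat (r (Suc j) div int p ^ j mod int p))"
  define z where "z = (\<lambda>k. if k < - int N then 0 else d (nat (k + int N)))"
  have d: "int (d j) = r (Suc j) div int p ^ j mod int p" for j
    by (simp add: d_def)
  have "residue N z m = r m mod int p ^ m" for m
  proof (induction m)
    case (Suc m)
    have "r (Suc m) mod int p ^ Suc m = int p ^ m * int (d m) + r (Suc m) mod int p ^ m"
      unfolding d power_Suc2 by (intro zmod_zmult2_eq) simp
    also have "r (Suc m) mod int p ^ m = r m mod int p ^ m"
      using assms[of m] by (simp add: cong_def)
    finally have "r (Suc m) mod int p ^ Suc m = int p ^ m * int (d m) + r m mod int p ^ m" .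
    moreover have "z (int m - int N) = d m" by (simp add: z_def)
    ultimately show ?case using Suc by (simp add: residue_Suc mult.commute)
  qed simp
  moreover have "z \<in> disc N"
  proof -
    have "d j < p" for j by (simp add: d_def nat_less_iff)
    then have "\<forall>k. z k < p" by (simp add: z_def)
    moreover have "\<forall>k < - int N. z k = 0" by (simp add: z_def)
    ultimately show ?thesis by (auto simp: disc_def Qp_def)
  qed
  ultimately show ?thesis by blast
qed

text \<open>For a constant sequence the residues stay equal to \<open>r\<close> from level
  \<open>m\<close> on, so all higher digits vanish.\<close>

lemma ex_residue:
  assumes "0 \<le> r" "r < int p ^ m"
  shows "\<exists>z\<in>disc N. (\<forall>k\<ge>int m - int N. z k = 0) \<and> residue N z m = r"
proof -
  obtain z where z: "z \<in> disc N" "\<forall>m. residue N z m = r mod int p ^ m"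
    using ex_residue_sequence[of "\<lambda>_. r" N] by auto
  have big: "residue N z m' = r" if "m \<le> m'" for m'
  proof -
    have "int p ^ m \<le> int p ^ m'" using that p_gt_1 by (intro power_increasing) auto
    then show ?thesis using z assms by simp
  qed
  have "z k = 0" if k: "int m - int N \<le> k" for k
  proof -
    define i where "i = nat (k + int N)"
    have i: "int i - int N = k" "m \<le> i" using k by (auto simp: i_def)
    have "int (z k) * int p ^ i = 0"
      using big[of "Suc i"] big[of i] i residue_Suc[of N z i] by simp
    then show ?thesis by simp
  qed
  then show ?thesis using z(1) big[of m] by blast
qed

section \<open>Subtraction computed through integer residues\<close>

lemma qp_trunc_disc:
  assumes x: "x \<in> disc N"
  shows "qp_trunc p x (int m - int N) = of_int (residue N x m) / of_nat p ^ N"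
proof -
  let ?f = "\<lambda>j. of_nat (x j) * (of_nat p :: rat) powi j"
  let ?h = "\<lambda>j. int j - int N"
  have sub: "{j. j < int m - int N \<and> x j \<noteq> 0} \<subseteq> ?h ` {..<m}"
  proof
    fix j assume j: "j \<in> {j. j < int m - int N \<and> x j \<noteq> 0}"
    then have "- int N \<le> j" using x by (auto simp: disc_def not_less[symmetric])
    then show "j \<in> ?h ` {..<m}" using j by (intro image_eqI[of _ _ "nat (j + int N)"]) auto
  qed
  have "qp_trunc p x (int m - int N) = sum ?f (?h ` {..<m})"
    unfolding qp_trunc_def by (rule sum.mono_neutral_left[OF _ sub]) auto
  also have "\<dots> = (\<Sum>j<m. ?f (int j - int N))"
    by (subst sum.reindex) (auto simp: inj_on_def)
  also have "\<dots> = (\<Sum>j<m. of_int (int (x (int j - int N)) * int p ^ j) / of_nat p ^ N)"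
    by (intro sum.cong) (auto simp: power_int_diff)
  also have "\<dots> = of_int (residue N x m) / of_nat p ^ N"
    by (simp add: residue_def sum_divide_distrib)
  finally show ?thesis .
qed

lemma qp_trunc_disc_0: "x \<in> disc N \<Longrightarrow> n \<le> - int N \<Longrightarrow> qp_trunc p x n = 0"
  unfolding qp_trunc_def by (intro sum.neutral) (auto simp: disc_def)

text \<open>Multiplying by \<open>p^N\<close> turns a congruence of rational truncations into an
  integer congruence modulo \<open>p^m\<close>.\<close>

lemma qcong_scaled:
  "qcong p (int m - int N) (of_int a / of_nat p ^ N) (of_int b / of_nat p ^ N - of_int c / of_nat p ^ N)
    \<longleftrightarrow> [a = b - c] (mod int p ^ m)"
proof -
  have eq: "(of_int a / of_nat p ^ N - (of_int b / of_nat p ^ N - of_int c / of_nat p ^ N)) /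
      of_nat p powi (int m - int N) = (of_int (a - (b - c)) :: rat) / of_int (int p ^ m)"
    by (simp add: power_int_diff field_simps)
  show ?thesis
    unfolding qcong_def eq cong_iff_dvd_diff
  proof
    assume "(of_int (a - (b - c)) :: rat) / of_int (int p ^ m) \<in> \<int>"
    then obtain k where "(of_int (a - (b - c)) :: rat) / of_int (int p ^ m) = of_int k"
      by (elim Ints_cases)
    then have "(of_int (a - (b - c)) :: rat) = of_int (int p ^ m * k)"
      by (simp add: field_simps)
    then have "a - (b - c) = int p ^ m * k" by (simp only: of_int_eq_iff)
    then show "int p ^ m dvd a - (b - c)" by simp
  next
    assume "int p ^ m dvd a - (b - c)"
    then obtain k where "a - (b - c) = int p ^ m * k" ..
    then show "(of_int (a - (b - c)) :: rat) / of_int (int p ^ m) \<in> \<int>" by simp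
  qed
qed

lemma qp_sub_spec_iff:
  assumes x: "x \<in> disc N" and y: "y \<in> disc N" and z: "z \<in> disc N"
  shows "(\<forall>n. qcong p n (qp_trunc p z n) (qp_trunc p x n - qp_trunc p y n)) \<longleftrightarrow>
    (\<forall>m. [residue N z m = residue N x m - residue N y m] (mod int p ^ m))" (is "?L \<longleftrightarrow> ?R")
proof
  assume L: ?L
  show ?R
  proof
    fix m
    show "[residue N z m = residue N x m - residue N y m] (mod int p ^ m)"
      using L[rule_format, of "int m - int N"] unfolding qp_trunc_disc[OF x] qp_trunc_disc[OF y]
        qp_trunc_disc[OF z] qcong_scaled .
  qed
next
  assume R: ?R
  show ?L
  proof
    fix n
    show "qcong p n (qp_trunc p z n) (qp_trunc p x n - qp_trunc p y n)"
    proof (cases "n \<le> - int N")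
      case True
      then show ?thesis by (simp add: qp_trunc_disc_0[OF x] qp_trunc_disc_0[OF y] qp_trunc_disc_0[OF z] qcong_def)
    next
      case False
      then have n: "n = int (nat (n + int N)) - int N" by simp
      then obtain m where "n = int m - int N" ..
      then show ?thesis
        using R qp_trunc_disc[OF x, of m] qp_trunc_disc[OF y, of m] qp_trunc_disc[OF z, of m]
        by (simp add: qcong_scaled)
    qed
  qed
qed

text \<open>Differences of residues are compatible, so the inverse limit supplies a value. The
  definite description also ranges over elements outside the disc, so uniqueness is checked in a
  larger disc containing the competitor.\<close>

lemma qp_sub_disc:
  assumes x: "x \<in> disc N" and y: "y \<in> disc N"
  shows "qp_sub p x y \<in> disc N"
    and "residue N (qp_sub p x y) m = (residue N x m - residue N y m) mod int p ^ m"
proof -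
  have xQ: "x \<in> Qp p" and yQ: "y \<in> Qp p" using x y disc_subset_Qp by auto
  have "[residue N x (Suc m) - residue N y (Suc m) = residue N x m - residue N y m] (mod int p ^ m)" for m
    using residue_mod[OF xQ, of m "Suc m"] residue_mod[OF yQ, of m "Suc m"]
      residue_mod[OF xQ order.refl] residue_mod[OF yQ order.refl]
    by (intro cong_diff) (auto simp: cong_def)
  then obtain z where z: "z \<in> disc N" "\<And>m. residue N z m = (residue N x m - residue N y m) mod int p ^ m"
    using ex_residue_sequence[of "\<lambda>m. residue N x m - residue N y m" N] by auto
  have "qp_sub p x y = z"
    unfolding qp_sub_def
  proof (rule the_equality)
    show "z \<in> Qp p \<and> (\<forall>n. qcong p n (qp_trunc p z n) (qp_trunc p x n - qp_trunc p y n))"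
      using z disc_subset_Qp unfolding qp_sub_spec_iff[OF x y z(1)] by (auto simp: cong_def)
  next
    fix w assume w: "w \<in> Qp p \<and> (\<forall>n. qcong p n (qp_trunc p w n) (qp_trunc p x n - qp_trunc p y n))"
    then obtain M where M: "w \<in> disc M" "N \<le> M" by (elim conjE Qp_ex_disc)
    then have xM: "x \<in> disc M" and yM: "y \<in> disc M" and zM: "z \<in> disc M"
      using x y z disc_mono by auto
    have zQ: "z \<in> Qp p" using z disc_subset_Qp by auto
    have "\<forall>m. [residue M w m = residue M x m - residue M y m] (mod int p ^ m)"
      using w qp_sub_spec_iff[OF xM yM M(1)] by blast
    \<comment> \<open>The defining congruences do not mention a disc, so for \<open>z\<close> they
      transfer from \<open>N\<close> to \<open>M\<close>.\<close>
    moreover have "\<forall>m. [residue M z m = residue M x m - residue M y m] (mod int p ^ m)"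
      using z unfolding qp_sub_spec_iff[OF xM yM zM, symmetric] qp_sub_spec_iff[OF x y z(1)]
      by (auto simp: cong_def)
    ultimately have "[residue M w m = residue M z m] (mod int p ^ m)" for m
      by (simp only: cong_def)
    then have eq: "residue M w m = residue M z m" for m
      using residue_mod[of w, OF _ order.refl] residue_mod[OF zQ order.refl] w by (simp add: cong_def)
    show "w = z"
    proof
      fix k
      show "w k = z k"
        using eq[of "nat (k + 1 + int M)"] unfolding residue_eq_iff[OF M(1) zM]
        using M(1) zM by (cases "k < - int M") (auto simp: disc_def)
    qed
  qed
  then show "qp_sub p x y \<in> disc N"
    "residue N (qp_sub p x y) m = (residue N x m - residue N y m) mod int p ^ m"
    using z by auto
qed

lemma Qp2_ex_disc:
  assumes "x \<in> Qp p" "y \<in> Qp p"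
  obtains N where "x \<in> disc N" "y \<in> disc N" "N0 \<le> N"
proof -
  obtain M where M: "x \<in> disc M" "N0 \<le> M" using Qp_ex_disc[OF assms(1)] .
  obtain N where N: "y \<in> disc N" "M \<le> N" using Qp_ex_disc[OF assms(2)] .
  show ?thesis using that[of N] M N disc_mono[of M N] by auto
qed

lemma qp_sub_in_Qp:
  assumes "x \<in> Qp p" "y \<in> Qp p"
  shows "qp_sub p x y \<in> Qp p"
proof -
  obtain N where "x \<in> disc N" "y \<in> disc N" "0 \<le> N" using Qp2_ex_disc[OF assms] .
  then show ?thesis using qp_sub_disc(1)[of x N y] disc_subset_Qp[of N] by auto
qed

text \<open>Both sides say that residues modulo a power of \<open>p\<close> coincide; this links the
  norm of a difference to balls defined by digits.\<close>

lemma qp_sub_digits_zero_iff: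
  assumes "x \<in> Qp p" "y \<in> Qp p"
  shows "(\<forall>k<n. qp_sub p x y k = 0) \<longleftrightarrow> (\<forall>k<n. x k = y k)"
proof -
  obtain N where N: "x \<in> disc N" "y \<in> disc N" "nat (- n) \<le> N" using Qp2_ex_disc[OF assms] .
  define m where "m = nat (n + int N)"
  have n: "n = int m - int N" using N(3) by (simp add: m_def)
  have "(\<forall>k<n. qp_sub p x y k = qp_zero k) \<longleftrightarrow> residue N (qp_sub p x y) m = residue N qp_zero m"
    unfolding n by (intro residue_eq_iff[symmetric] qp_sub_disc N) simp
  also have "\<dots> \<longleftrightarrow> residue N x m = residue N y m"
    using residue_bounds[OF assms(1), of N m] residue_bounds[OF assms(2), of N m]
    by (simp add: qp_sub_disc[OF N(1,2)] mod_eq_dvd_iff[symmetric] flip: dvd_eq_mod_eq_0)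
  also have "\<dots> \<longleftrightarrow> (\<forall>k<n. x k = y k)"
    unfolding n by (rule residue_eq_iff[OF N(1,2)])
  finally show ?thesis by (simp add: qp_zero_def)
qed

section \<open>Passing to the next larger disc\<close>

lemma residue_disc_Suc:
  assumes "x \<in> disc N"
  shows "residue (Suc N) x (Suc m) = int p * residue N x m"
proof -
  have "x (- 1 - int N) = 0" using assms by (simp add: disc_def)
  then show ?thesis
    unfolding residue_def by (subst sum.lessThan_Suc_shift) (simp add: sum_distrib_left algebra_simps)
qed

lemma in_disc_iff_dvd_residue:
  assumes "x \<in> disc (Suc N)"
  shows "x \<in> disc N \<longleftrightarrow> int p dvd residue (Suc N) x (Suc m)"
proof -
  have x: "x \<in> Qp p" using assms disc_subset_Qp by auto
  have "x \<in> disc N \<longleftrightarrow> x (- 1 - int N) = 0"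
  proof
    assume "x (- 1 - int N) = 0"
    moreover have "k < - int N \<longleftrightarrow> k < - int (Suc N) \<or> k = - 1 - int N" for k by auto
    ultimately show "x \<in> disc N" using assms by (auto simp: disc_def)
  qed (simp add: disc_def)
  also have "\<dots> \<longleftrightarrow> residue (Suc N) x 1 = 0"
    by (simp add: residue_def)
  also have "\<dots> \<longleftrightarrow> int p dvd residue (Suc N) x (Suc m)"
    using residue_mod[OF x, of 1 "Suc m" "Suc N"] by (simp add: dvd_eq_mod_eq_0)
  finally show ?thesis .
qed

lemma residue_ppow: "residue N (qp_ppow 1 x) m = residue (Suc N) x m"
  by (simp add: residue_def qp_ppow_def algebra_simps)

lemma ppow_in_disc_iff: "qp_ppow 1 x \<in> disc N \<longleftrightarrow> x \<in> disc (Suc N)"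
proof -
  have "(\<forall>k < - int N. x (k - 1) = 0) \<longleftrightarrow> (\<forall>k < - 1 - int N. x k = 0)"
  proof (intro iffI allI impI)
    fix k assume "\<forall>k < - int N. x (k - 1) = 0" "k < - 1 - int N"
    then show "x k = 0" by (auto dest!: spec[of _ "k + 1"])
  qed auto
  then show ?thesis by (simp add: disc_def) (simp add: qp_ppow_def)
qed

end

section \<open>Refinable sequences\<close>

text \<open>Polynomials act on two-sided sequences through the shift operator \<open>(X u) r = u (r - 1)\<close>.\<close>
definition shift_poly :: "complex poly \<Rightarrow> (int \<Rightarrow> complex) \<Rightarrow> int \<Rightarrow> complex" where
  "shift_poly q u r = (\<Sum>i\<le>degree q. coeff q i * u (r - int i))"

lemma shift_poly_eq_sum:
  assumes "degree q \<le> n"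
  shows "shift_poly q u r = (\<Sum>i\<le>n. coeff q i * u (r - int i))"
  unfolding shift_poly_def
  by (rule sum.mono_neutral_left) (use assms in \<open>auto simp: coeff_eq_0\<close>)

lemma shift_poly_0 [simp]: "shift_poly 0 u r = 0"
  by (simp add: shift_poly_def)

lemma shift_poly_add: "shift_poly (q + s) u r = shift_poly q u r + shift_poly s u r"
proof -
  define n where "n = max (degree q) (degree s)"
  have "degree q \<le> n" "degree s \<le> n" "degree (q + s) \<le> n"
    by (auto simp: n_def intro: degree_add_le)
  then show ?thesis
    by (simp add: shift_poly_eq_sum[where n = n] distrib_right sum.distrib)
qed

lemma shift_poly_smult: "shift_poly (smult a q) u r = a * shift_poly q u r"
  using shift_poly_eq_sum[OF degree_smult_le[of a q]]
  by (simp add: shift_poly_def sum_distrib_left mult.assoc)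

lemma shift_poly_diff: "shift_poly (q - s) u r = shift_poly q u r - shift_poly s u r"
  using shift_poly_add[of q "- s" u r] shift_poly_smult[of "-1" s u r] by simp

lemma shift_poly_pCons: "shift_poly (pCons a q) u r = a * u r + shift_poly q u (r - 1)"
proof -
  have "shift_poly (pCons a q) u r = (\<Sum>i\<le>Suc (degree q). coeff (pCons a q) i * u (r - int i))"
    by (intro shift_poly_eq_sum degree_pCons_le)
  also have "\<dots> = a * u r + (\<Sum>i\<le>degree q. coeff q i * u (r - 1 - int i))"
    by (subst sum.atMost_Suc_shift) (simp add: algebra_simps)
  finally show ?thesis by (simp add: shift_poly_def)
qed

lemma shift_poly_mult: "shift_poly (q * s) u r = shift_poly q (shift_poly s u) r"
proof (induction q arbitrary: r)
  case (pCons a q)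
  then show ?case
    by (simp add: shift_poly_add shift_poly_smult shift_poly_pCons)
qed simp

lemma shift_poly_monom: "shift_poly (monom a n) u r = a * u (r - int n)"
proof -
  have "shift_poly (monom a n) u r = (\<Sum>i\<le>n. coeff (monom a n) i * u (r - int i))"
    by (intro shift_poly_eq_sum degree_monom_le)
  also have "\<dots> = (\<Sum>i\<le>n. if i = n then a * u (r - int i) else 0)"
    by (intro sum.cong) auto
  finally show ?thesis by simp
qed

lemma shift_poly_sum_monom:
  "shift_poly (\<Sum>i\<in>I. monom (c i) (e i)) u r = (\<Sum>i\<in>I. c i * u (r - int (e i)))"
  by (induction I rule: infinite_finite_induct) (auto simp: shift_poly_add shift_poly_monom)

text \<open>Upsampling: on generating functions this is the substitution of \<open>X^p\<close> for
  \<open>X\<close>.\<close>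

definition inflate :: "nat \<Rightarrow> (int \<Rightarrow> complex) \<Rightarrow> int \<Rightarrow> complex" where
  "inflate p u r = (if int p dvd r then u (r div int p) else 0)"

text \<open>Splitting a polynomial by the residues of its exponents modulo \<open>p\<close> turns an annihilator
  of \<open>inflate p u\<close> into annihilators of \<open>u\<close>, one of which has degree \<open>degree g div p\<close>.\<close>
lemma inflate_annihilator:
  assumes p: "0 < p" and g: "g \<noteq> 0" "\<And>r. shift_poly g (inflate p u) r = 0"
  shows "\<exists>q. q \<noteq> 0 \<and> degree q = degree g div p \<and> (\<forall>r. shift_poly q u r = 0)"
proof -
  define d where "d = degree g"
  \<comment> \<open>The residue class of the leading exponent is chosen so that \<open>q\<close>
    inherits a nonzero leading coefficient.\<close>
  define s where "s = d mod p"
  define e where "e = d div p"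
  define q where "q = (\<Sum>i\<le>e. monom (coeff g (p * i + s)) i)"
  have d: "d = p * e + s" by (simp add: e_def s_def)
  have coeff_q: "coeff q i = (if i \<le> e then coeff g (p * i + s) else 0)" for i
    by (simp add: q_def coeff_sum)
  have lead: "coeff q e \<noteq> 0" using g by (simp add: coeff_q d[symmetric]) (simp add: d_def)
  have "degree q \<le> e" unfolding q_def by (intro degree_sum_le order.trans[OF degree_monom_le]) auto
  then have deg: "degree q = e" using le_degree[OF lead] by simp
  have "shift_poly q u r = 0" for r
  proof -
    let ?f = "\<lambda>j. coeff g j * inflate p u (int p * r + int s - int j)"
    have "0 = (\<Sum>j\<le>d. ?f j)"
      using g(2)[of "int p * r + int s"] by (simp add: shift_poly_def d_def)
    also have "\<dots> = (\<Sum>j\<in>(\<lambda>i. p * i + s) ` {..e}. ?f j)"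
    proof (rule sum.mono_neutral_right)
      show "\<forall>j\<in>{..d} - (\<lambda>i. p * i + s) ` {..e}. ?f j = 0"
      proof
        fix j assume j: "j \<in> {..d} - (\<lambda>i. p * i + s) ` {..e}"
        have "\<not> int p dvd int p * r + int s - int j"
        proof
          assume "int p dvd int p * r + int s - int j"
          then have "int p dvd int s - int j" by (metis add_diff_eq dvd_add_triv_left_iff dvd_triv_left dvd_add_right_iff)
          then have "int s mod int p = int j mod int p" by (simp add: mod_eq_dvd_iff)
          then have "int (s mod p) = int (j mod p)" by (simp only: zmod_int)
          then have "j mod p = s" by (simp add: s_def)
          then have j': "j = p * (j div p) + s" by (metis mult_div_mod_eq)
          moreover have "j div p \<le> e" using j by (auto simp: e_def intro: div_le_mono)
          ultimately show False using j by blast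
        qed
        then show "?f j = 0" by (simp add: inflate_def)
      qed
    qed (auto simp: d)
    also have "\<dots> = (\<Sum>i\<le>e. ?f (p * i + s))"
      using p by (subst sum.reindex) (auto simp: inj_on_def)
    also have "\<dots> = (\<Sum>i\<le>e. coeff g (p * i + s) * u (r - int i))"
    proof (intro sum.cong refl arg_cong2[where f = "(*)"])
      fix i
      have "int p * r + int s - int (p * i + s) = int p * (r - int i)" by (simp add: algebra_simps)
      then show "inflate p u (int p * r + int s - int (p * i + s)) = u (r - int i)"
        using p by (simp add: inflate_def)
    qed
    also have "\<dots> = shift_poly q u r"
      unfolding q_def shift_poly_sum_monom by simp
    finally show ?thesis by simp
  qed
  then show ?thesis using lead deg by (intro exI[of _ q]) (auto simp: e_def d_def)
qed

lemma periodic_int_mod: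
  fixes f :: "int \<Rightarrow> 'a"
  assumes per: "\<And>r. f (r + P) = f r"
  shows "f (r mod P) = f r"
proof -
  have per': "f (r + P * z) = f r" for r z
  proof (induction z rule: int_induct[where k = 0])
    case (step1 i)
    then show ?case using per[of "r + P * i"] by (simp add: algebra_simps)
  next
    case (step2 i)
    then show ?case using per[of "r + P * (i - 1)"] by (simp add: algebra_simps)
  qed simp
  show ?thesis using per'[of "r mod P" "r div P"] by simp
qed

lemma sum_periodic_shift:
  fixes f :: "int \<Rightarrow> complex"
  assumes P: "0 < P" and per: "\<And>r. f (r + int P) = f r"
  shows "(\<Sum>r\<in>{0..<int P}. f (r - k)) = (\<Sum>r\<in>{0..<int P}. f r)"
proof -
  have f_mod: "f (r mod int P) = f r" for r
    by (rule periodic_int_mod[of f "int P", OF per])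
  have "(\<Sum>r\<in>{0..<int P}. f (r - k)) = (\<Sum>r\<in>{0..<int P}. f ((r - k) mod int P))"
    by (simp add: f_mod)
  also have "\<dots> = (\<Sum>r\<in>{0..<int P}. f r)"
  proof (rule sum.reindex_bij_witness[where i = "\<lambda>r. (r + k) mod int P" and j = "\<lambda>r. (r - k) mod int P"])
    fix r assume r: "r \<in> {0..<int P}"
    show "((r - k) mod int P + k) mod int P = r" using r by (simp add: mod_simps)
    show "((r + k) mod int P - k) mod int P = r" using r by (simp add: mod_simps)
  qed (use P in auto)
  finally show ?thesis .
qed

text \<open>Let \<open>\<mu>\<close> be a minimal annihilator of \<open>u\<close>, of degree \<open>D\<close>.
  Annihilators of \<open>v = inflate p u\<close> have degree at least \<open>p D\<close>. If \<open>D > n\<close>, then the polynomial \<open>h\<close>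
  with \<open>h v = u\<close> has degree at most \<open>p n - n\<close> (otherwise some \<open>X\<^sup>k h - h\<^sub>k\<close> is an annihilator of \<open>v\<close>
  of degree \<open>p n\<close>), so the annihilator \<open>\<mu> h\<close> of \<open>v\<close> has degree less than \<open>p D\<close>.\<close>
lemma annihilator_degree_le:
  assumes p: "1 < p" and n: "0 < n" and u: "u \<noteq> (\<lambda>r. 0)"
    and per: "0 < P" "\<And>r. u (r + int P) = u r"
    and refine: "\<And>k. k < n \<Longrightarrow> \<exists>c. \<forall>r. u (r - int k) = (\<Sum>j<p * n. c j * inflate p u (r - int j))"
  shows "\<exists>\<mu>. \<mu> \<noteq> 0 \<and> degree \<mu> \<le> n \<and> (\<forall>r. shift_poly \<mu> u r = 0)"
proof -
  define v where "v = inflate p u"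
  define A where "A = (\<lambda>q. q \<noteq> 0 \<and> (\<forall>r. shift_poly q u r = 0))"
  \<comment> \<open>Periodicity gives the annihilator \<open>X^P - 1\<close>, so a minimal one
    exists.\<close>
  have "A (monom 1 P - 1)"
    unfolding A_def
  proof
    have "coeff (monom 1 P - 1 :: complex poly) P = 1" using per(1) by simp
    then show "monom 1 P - 1 \<noteq> (0 :: complex poly)" by (metis coeff_0 zero_neq_one)
    show "\<forall>r. shift_poly (monom 1 P - 1) u r = 0"
    proof
      fix r
      have "shift_poly 1 u r = u r" by (simp add: shift_poly_def)
      then show "shift_poly (monom 1 P - 1) u r = 0"
        using per(2)[of "r - int P"] by (simp add: shift_poly_diff shift_poly_monom)
    qed
  qed
  then obtain \<mu> where \<mu>: "A \<mu>" and min: "\<And>q. A q \<Longrightarrow> degree \<mu> \<le> degree q"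
    using arg_min_nat_lemma[of A _ degree] by metis
  define D where "D = degree \<mu>"
  have v_ann: "p * D \<le> degree g" if g: "g \<noteq> 0" "\<And>r. shift_poly g v r = 0" for g
  proof -
    obtain q where "q \<noteq> 0" "degree q = degree g div p" "\<forall>r. shift_poly q u r = 0"
      using inflate_annihilator[OF _ g[unfolded v_def]] p by auto
    then have "D \<le> degree g div p" using min[of q] by (auto simp: A_def D_def)
    then show ?thesis using p by (simp add: less_eq_div_iff_mult_less_eq mult.commute)
  qed
  have ex_h: "\<exists>h. degree h < p * n \<and> (\<forall>r. shift_poly h v r = u (r - int k))" if k: "k < n" for k
  proof -
    obtain c where c: "\<forall>r. u (r - int k) = (\<Sum>j<p * n. c j * v (r - int j))"
      using refine[OF k] by (auto simp: v_def)
    have "degree (\<Sum>j<p * n. monom (c j) j) \<le> p * n - 1"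
      by (intro degree_sum_le order.trans[OF degree_monom_le]) auto
    moreover have "0 < p * n" using p n by simp
    ultimately have "degree (\<Sum>j<p * n. monom (c j) j) < p * n" by linarith
    then show ?thesis
      using c by (intro exI[of _ "\<Sum>j<p * n. monom (c j) j"]) (auto simp: shift_poly_sum_monom)
  qed
  have "D \<le> n"
  proof (rule ccontr)
    assume "\<not> D \<le> n"
    then have Dn: "n < D" by simp
    obtain h where h: "degree h < p * n" "\<forall>r. shift_poly h v r = u r"
      using ex_h[of 0] n by auto
    have h0: "h \<noteq> 0"
    proof
      assume "h = 0"
      then have "u = (\<lambda>r. 0)" using h(2) by auto
      then show False using u by simp
    qed
    have deg_h: "degree h + n \<le> p * n"
    proof (rule ccontr)
      assume large: "\<not> degree h + n \<le> p * n"
      \<comment> \<open>This \<open>k\<close> gives \<open>X^k h\<close> degree exactly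
        \<open>p n\<close>, while \<open>g\<close> produces the same shift with smaller degree; the
        leading term cannot cancel in the difference.\<close>
      define k where "k = p * n - degree h"
      have k: "k < n" "degree h + k = p * n" using large h(1) by (auto simp: k_def)
      obtain g where g: "degree g < p * n" "\<forall>r. shift_poly g v r = u (r - int k)"
        using ex_h[OF k(1)] by blast
      have deg: "degree (monom 1 k * h) = p * n"
        using h0 k(2) by (simp add: degree_mult_eq degree_monom_eq)
      have "degree (monom 1 k * h - g) = p * n"
        using deg g(1) degree_add_eq_left[of "- g" "monom 1 k * h"] by simp
      moreover have "monom 1 k * h - g \<noteq> 0" using deg g(1) by auto
      moreover have "shift_poly (monom 1 k * h - g) v r = 0" for r
        using g(2) h(2) by (simp add: shift_poly_diff shift_poly_mult shift_poly_monom)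
      ultimately have "p * D \<le> p * n" using v_ann by metis
      then show False using Dn p by simp
    qed
    have "shift_poly (\<mu> * h) v r = 0" for r
    proof -
      have "shift_poly h v = u" using h(2) by auto
      then show ?thesis using \<mu> by (simp add: shift_poly_mult A_def)
    qed
    moreover have "\<mu> * h \<noteq> 0" using \<mu> h0 by (simp add: A_def)
    ultimately have "p * D \<le> D + degree h"
      using v_ann[of "\<mu> * h"] \<mu> h0 by (simp add: degree_mult_eq A_def D_def)
    \<comment> \<open>Here \<open>Suc p'\<close> is \<open>p - 1\<close>: the bounds
      \<open>p D \<le> D + degree h\<close> and \<open>degree h \<le> (p - 1) n\<close> combine to
      \<open>(p - 1) D \<le> (p - 1) n\<close>.\<close>
    moreover obtain p' where "p = Suc (Suc p')" using p by (metis One_nat_def less_imp_Suc_add add_Suc_shift plus_nat.simps(2))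
    ultimately have "Suc p' * D \<le> Suc p' * n" using deg_h by simp
    then show False using Dn by (metis mult_le_cancel1 not_less zero_less_Suc)
  qed
  then show ?thesis using \<mu> by (auto simp: A_def D_def)
qed

text \<open>An annihilator of degree at most \<open>n\<close> expresses the shift by
  \<open>n\<close> through the first \<open>n\<close> shifts; orthogonality leaves only the
  coefficient \<open>c\<close> of \<open>u\<close> itself, and periodicity together with
  refinability forces \<open>c = 1\<close>.\<close>

lemma refinable_orthogonal_periodic:
  assumes p: "1 < p" and n: "0 < n"
    and per: "P = n * p ^ e" "\<And>r. u (r + int P) = u r"
    and orth: "\<And>k l. k < n \<Longrightarrow> l < n \<Longrightarrow>
      (\<Sum>r\<in>{0..<int P}. u (r - int k) * cnj (u (r - int l))) = (if k = l then K else 0)"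
    and K: "K \<noteq> 0"
    and refine: "\<And>k. k < n \<Longrightarrow> \<exists>c. \<forall>r. u (r - int k) = (\<Sum>j<p * n. c j * inflate p u (r - int j))"
  shows "u (r - int n) = u r"
proof -
  have P: "0 < P" using p n by (simp add: per(1))
  have u0: "u \<noteq> (\<lambda>r. 0)" using orth[of 0 0] n K by auto
  obtain \<mu> where \<mu>: "\<mu> \<noteq> 0" "degree \<mu> \<le> n" "\<And>r. shift_poly \<mu> u r = 0"
    using annihilator_degree_le[OF p n u0 P per(2) refine] by blast
  define D where "D = degree \<mu>"
  \<comment> \<open>The annihilator is multiplied by \<open>X^(n - D)\<close> to reach degree
    exactly \<open>n\<close> and solved for its leading term.\<close>
  define b where "b = (\<lambda>i. if i < n - D then 0 else - coeff \<mu> (i - (n - D)) / lead_coeff \<mu>)"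
  have expand: "u (r - int n) = (\<Sum>i<n. b i * u (r - int i))" for r
  proof -
    have "(\<Sum>i<n. b i * u (r - int i)) = (\<Sum>i\<in>(\<lambda>i. i + (n - D)) ` {..<D}. b i * u (r - int i))"
    proof (rule sum.mono_neutral_right)
      show "\<forall>i\<in>{..<n} - (\<lambda>i. i + (n - D)) ` {..<D}. b i * u (r - int i) = 0"
      proof
        fix i assume i: "i \<in> {..<n} - (\<lambda>i. i + (n - D)) ` {..<D}"
        have "i < n - D"
        proof (rule ccontr)
          assume "\<not> i < n - D"
          then have "i = (i - (n - D)) + (n - D)" "i - (n - D) < D" using i \<mu>(2) by (auto simp: D_def)
          then show False using i by blast
        qed
        then show "b i * u (r - int i) = 0" by (simp add: b_def)
      qed
    qed (use \<mu>(2) in \<open>auto simp: D_def\<close>)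
    also have "\<dots> = (\<Sum>i<D. b (i + (n - D)) * u (r - int (i + (n - D))))"
      by (subst sum.reindex) (auto simp: inj_on_def)
    also have "\<dots> = - (\<Sum>i<D. coeff \<mu> i * u (r - int (n - D) - int i)) / lead_coeff \<mu>"
      by (simp add: b_def sum_divide_distrib sum_negf[symmetric] algebra_simps)
    also have "\<dots> = u (r - int n)"
    proof -
      have "0 = (\<Sum>i<D. coeff \<mu> i * u (r - int (n - D) - int i)) + lead_coeff \<mu> * u (r - int (n - D) - int D)"
        using \<mu>(3)[of "r - int (n - D)"] by (simp add: shift_poly_def D_def lessThan_Suc_atMost[symmetric])
      moreover have "r - int (n - D) - int D = r - int n" using \<mu>(2) by (simp add: D_def)
      ultimately have "- (\<Sum>i<D. coeff \<mu> i * u (r - int (n - D) - int i)) = lead_coeff \<mu> * u (r - int n)"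
        by (metis minus_unique add.commute minus_minus)
      then show ?thesis using \<mu>(1) by simp
    qed
    finally show ?thesis by simp
  qed
  have b0: "b l = 0" if l: "0 < l" "l < n" for l
  proof -
    \<comment> \<open>Shifting by \<open>l\<close> turns the pair \<open>n\<close>, \<open>l\<close>
      into \<open>n - l\<close>, \<open>0\<close>, to which orthogonality applies because
      \<open>0 < l < n\<close>.\<close>
    have "(\<Sum>r\<in>{0..<int P}. u (r - int n) * cnj (u (r - int l))) =
      (\<Sum>r\<in>{0..<int P}. (\<lambda>s. u (s - int (n - l)) * cnj (u (s - int 0))) (r - int l))"
      using l by (intro sum.cong) (auto simp: algebra_simps)
    also have "\<dots> = (\<Sum>s\<in>{0..<int P}. u (s - int (n - l)) * cnj (u (s - int 0)))"
    proof (intro sum_periodic_shift P)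
      fix r show "u (r + int P - int (n - l)) * cnj (u (r + int P - int 0)) = u (r - int (n - l)) * cnj (u (r - int 0))"
        using per(2)[of "r - int (n - l)"] per(2)[of r] by (simp add: algebra_simps)
    qed
    also have "\<dots> = 0" using orth[of "n - l" 0] l by simp
    finally have "0 = (\<Sum>r\<in>{0..<int P}. \<Sum>i<n. b i * (u (r - int i) * cnj (u (r - int l))))"
      unfolding expand by (simp add: sum_distrib_right mult.assoc)
    also have "\<dots> = (\<Sum>i<n. b i * (\<Sum>r\<in>{0..<int P}. u (r - int i) * cnj (u (r - int l))))"
      by (subst sum.swap) (simp add: sum_distrib_left)
    also have "\<dots> = (\<Sum>i<n. if i = l then b i * K else 0)"
      using orth l by (intro sum.cong) auto
    also have "\<dots> = b l * K" using l by simp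
    finally show ?thesis using K by simp
  qed
  define c where "c = b 0"
  have eig: "u (r - int n) = c * u r" for r
  proof -
    have "u (r - int n) = (\<Sum>i<n. if i = 0 then b i * u (r - int i) else 0)"
      unfolding expand using b0 by (intro sum.cong) auto
    then show ?thesis using n by (simp add: c_def)
  qed
  have pow: "u (r - int n * int i) = c ^ i * u r" for i r
  proof (induction i)
    case (Suc i)
    then show ?case using eig[of "r - int n * int i"] by (simp add: algebra_simps)
  qed simp
  obtain r0 where r0: "u r0 \<noteq> 0" using u0 by auto
  have "c ^ (p ^ e) * u r0 = u r0"
    using pow[of r0 "p ^ e"] per(2)[of "r0 - int P"] by (simp add: per(1))
  then have c_unit: "c ^ (p ^ e) = 1" using r0 by simp
  have "c ^ p = c"
  proof -
    obtain a where a: "\<forall>r. u r = (\<Sum>j<p * n. a j * inflate p u (r - int j))"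
      using refine[OF n] by auto
    \<comment> \<open>Inflation turns the shift by \<open>n\<close> into the shift by
      \<open>p n\<close>, so refinement gives \<open>u\<close> the factor \<open>c\<close> there,
      while iterating the eigenvalue gives \<open>c ^ p\<close>.\<close>
    have infl: "inflate p u (r - int p * int n) = c * inflate p u r" for r
    proof (cases "int p dvd r")
      case True
      then obtain q where q: "r = int p * q" ..
      then have "r - int p * int n = int p * (q - int n)" by (simp add: algebra_simps)
      then show ?thesis using q p eig[of q] by (simp add: inflate_def)
    next
      case False
      then have "\<not> int p dvd r - int p * int n"
        by (metis dvd_diff_commute dvd_triv_left dvd_diffD diff_add_cancel dvd_add)
      then show ?thesis using False by (simp add: inflate_def)
    qed
    have "u (r0 - int p * int n) = (\<Sum>j<p * n. a j * inflate p u (r0 - int j - int p * int n))"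
      using a by (simp add: algebra_simps)
    also have "\<dots> = c * u r0"
      unfolding infl using a by (simp add: sum_distrib_left algebra_simps)
    finally show ?thesis using pow[of r0 p] r0 by (simp add: mult.commute)
  qed
  \<comment> \<open>Iterating \<open>c ^ p = c\<close> shows that the power which periodicity made 1
    is \<open>c\<close> itself.\<close>
  then have "c ^ (p ^ i) = c" for i
    by (induction i) (simp_all add: power_mult)
  then have "c = 1" using c_unit by simp
  then show ?thesis using eig by simp
qed

section \<open>Step functions\<close>

text \<open>By Pythagoras, no element of the span is closer to \<open>G\<close> than its orthogonal projection.\<close>
lemma orthogonal_span_closed:
  fixes w :: "nat \<Rightarrow> 'a \<Rightarrow> complex" and K :: complex
  assumes X: "finite X" and K: "K \<noteq> 0"
    and orth: "\<And>i j. i < n \<Longrightarrow> j < n \<Longrightarrow> (\<Sum>r\<in>X. w i r * cnj (w j r)) = (if i = j then K else 0)"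
    and approx: "\<And>e. 0 < e \<Longrightarrow> \<exists>c. (\<Sum>r\<in>X. (cmod (G r - (\<Sum>j<n. c j * w j r)))\<^sup>2) < e"
  shows "\<exists>c. \<forall>r\<in>X. G r = (\<Sum>j<n. c j * w j r)"
proof -
  define b where "b = (\<lambda>j. (\<Sum>r\<in>X. G r * cnj (w j r)) / K)"
  define H where "H = (\<lambda>r. G r - (\<Sum>j<n. b j * w j r))"
  define E where "E = (\<Sum>r\<in>X. (cmod (H r))\<^sup>2)"
  have H_orth: "(\<Sum>r\<in>X. H r * cnj (w i r)) = 0" if i: "i < n" for i
  proof -
    have "(\<Sum>r\<in>X. (\<Sum>j<n. b j * w j r) * cnj (w i r)) = (\<Sum>j<n. b j * (\<Sum>r\<in>X. w j r * cnj (w i r)))"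
      by (simp add: sum_distrib_right sum_distrib_left mult.assoc) (rule sum.swap)
    also have "\<dots> = (\<Sum>j<n. if j = i then b j * K else 0)"
      using orth i by (intro sum.cong) auto
    also have "\<dots> = (\<Sum>r\<in>X. G r * cnj (w i r))" using i K by (simp add: b_def)
    finally show ?thesis by (simp add: H_def left_diff_distrib sum_subtractf)
  qed
  have span_orth: "(\<Sum>r\<in>X. H r * cnj (\<Sum>j<n. c j * w j r)) = 0" for c
  proof -
    have "(\<Sum>r\<in>X. H r * cnj (\<Sum>j<n. c j * w j r)) = (\<Sum>r\<in>X. \<Sum>j<n. cnj (c j) * (H r * cnj (w j r)))"
      by (simp add: sum_distrib_left algebra_simps)
    also have "\<dots> = (\<Sum>j<n. cnj (c j) * (\<Sum>r\<in>X. H r * cnj (w j r)))"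
      by (subst sum.swap) (simp add: sum_distrib_left)
    finally show ?thesis using H_orth by simp
  qed
  have E_le: "E \<le> (\<Sum>r\<in>X. (cmod (G r - (\<Sum>j<n. c j * w j r)))\<^sup>2)" for c
  proof -
    define F where "F = (\<lambda>r. G r - (\<Sum>j<n. c j * w j r))"
    \<comment> \<open>\<open>H\<close> is orthogonal to the span and \<open>F - H\<close> lies in
      it, so pairing \<open>H\<close> with \<open>F\<close> yields \<open>E\<close>; the
      arithmetic-geometric mean inequality then bounds \<open>E\<close> by the mean of
      \<open>E\<close> and the squared norm of \<open>F\<close>.\<close>
    have "(\<Sum>r\<in>X. H r * cnj (F r)) = (\<Sum>r\<in>X. H r * cnj (G r))"
      using span_orth[of c] by (simp add: F_def right_diff_distrib sum_subtractf)
    also have "\<dots> = (\<Sum>r\<in>X. H r * cnj (H r))"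
      using span_orth[of b] by (simp add: H_def right_diff_distrib sum_subtractf)
    also have "\<dots> = of_real E"
      by (simp add: E_def complex_norm_square[symmetric] flip: of_real_power)
    finally have HF: "(\<Sum>r\<in>X. H r * cnj (F r)) = of_real E" .
    have "0 \<le> E" by (simp add: E_def sum_nonneg)
    then have "E = cmod (\<Sum>r\<in>X. H r * cnj (F r))" unfolding HF by simp
    also have "\<dots> \<le> (\<Sum>r\<in>X. cmod (H r) * cmod (F r))"
      by (rule order.trans[OF norm_sum]) (simp add: norm_mult)
    also have "\<dots> \<le> (\<Sum>r\<in>X. ((cmod (H r))\<^sup>2 + (cmod (F r))\<^sup>2) / 2)"
    proof (intro sum_mono)
      fix r
      show "cmod (H r) * cmod (F r) \<le> ((cmod (H r))\<^sup>2 + (cmod (F r))\<^sup>2) / 2"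
        using sum_squares_bound[of "cmod (H r)" "cmod (F r)"] by simp
    qed
    also have "\<dots> = (E + (\<Sum>r\<in>X. (cmod (F r))\<^sup>2)) / 2"
      by (simp add: E_def sum.distrib flip: sum_divide_distrib)
    finally show ?thesis by (simp add: F_def)
  qed
  have "E \<le> 0"
  proof (rule field_le_epsilon)
    fix e :: real assume "0 < e"
    then obtain c where "(\<Sum>r\<in>X. (cmod (G r - (\<Sum>j<n. c j * w j r)))\<^sup>2) < e" using approx by blast
    then show "E \<le> 0 + e" using E_le[of c] by simp
  qed
  then have "E = 0" by (simp add: E_def sum_nonneg order_antisym)
  then have "\<forall>r\<in>X. H r = 0" using X by (simp add: E_def sum_nonneg_eq_0_iff)
  then show ?thesis by (intro exI[of _ b]) (simp add: H_def)
qed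

context padic
begin

text \<open>A function supported in \<open>p^(-N) Z_p\<close> and constant on balls of radius
  \<open>p^(N - m)\<close>, encoded by its values at residues. Periodic extension to all integers
  turns translation into an index shift; values outside \<open>Qp p\<close> are left free.\<close>

definition is_step :: "nat \<Rightarrow> nat \<Rightarrow> (int \<Rightarrow> complex) \<Rightarrow> (qp \<Rightarrow> complex) \<Rightarrow> bool" where
  "is_step N m u f \<longleftrightarrow> (\<forall>r. u (r + int p ^ m) = u r) \<and>
    (\<forall>x\<in>Qp p. f x = (if x \<in> disc N then u (residue N x m) else 0))"

lemma is_step_mod: "is_step N m u f \<Longrightarrow> u (r mod int p ^ m) = u r"
  by (intro periodic_int_mod) (simp add: is_step_def)

lemma is_step_transl:
  assumes f: "is_step N m u f" and a: "a \<in> disc N"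
  shows "is_step N m (\<lambda>r. u (r - residue N a m)) (qp_transl p a f)"
  unfolding is_step_def
proof (intro conjI allI ballI)
  fix r
  have "u (r - residue N a m + int p ^ m) = u (r - residue N a m)" using f by (simp add: is_step_def)
  then show "u (r + int p ^ m - residue N a m) = u (r - residue N a m)" by (simp add: algebra_simps)
next
  fix x assume x: "x \<in> Qp p"
  have aQ: "a \<in> Qp p" using a disc_subset_Qp by auto
  have "qp_sub p x a \<in> disc N \<longleftrightarrow> x \<in> disc N"
  proof -
    have "(\<forall>k < - int N. qp_sub p x a k = 0) \<longleftrightarrow> (\<forall>k < - int N. x k = 0)"
      unfolding qp_sub_digits_zero_iff[OF x aQ] using a by (auto simp: disc_def)
    then show ?thesis using x qp_sub_in_Qp[OF x aQ] by (simp add: disc_def)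
  qed
  then show "qp_transl p a f x = (if x \<in> disc N then u (residue N x m - residue N a m) else 0)"
    using f qp_sub_in_Qp[OF x aQ] qp_sub_disc(2)[OF _ a, of x m] is_step_mod[OF f]
    by (simp add: is_step_def qp_transl_def)
qed

text \<open>The translated support lies in another coset of the disc, hence is disjoint from
  it.\<close>

lemma is_step_transl_eq_0:
  assumes f: "is_step N m u f" and a: "a \<in> Qp p" "a \<notin> disc N" and x: "x \<in> disc N"
  shows "qp_transl p a f x = 0"
proof -
  have xQ: "x \<in> Qp p" using x disc_subset_Qp by auto
  have "qp_sub p x a \<notin> disc N"
  proof
    assume "qp_sub p x a \<in> disc N"
    then have "\<forall>k < - int N. x k = a k"
      unfolding qp_sub_digits_zero_iff[OF xQ a(1), symmetric] by (simp add: disc_def)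
    then show False using a x by (auto simp: disc_def)
  qed
  then show ?thesis using f qp_sub_in_Qp[OF xQ a(1)] by (simp add: is_step_def qp_transl_def)
qed

text \<open>On the next larger disc, \<open>f\<close> vanishes at the residues not divisible by \<open>p\<close>, which is what
  \<open>inflate\<close> records.\<close>
lemma is_step_inflate:
  assumes f: "is_step N m u f"
  shows "is_step (Suc N) (Suc m) (inflate p u) f"
  unfolding is_step_def
proof (intro conjI allI ballI)
  fix r
  have "(r + int p * int p ^ m) div int p = r div int p + int p ^ m"
    "int p dvd r + int p * int p ^ m \<longleftrightarrow> int p dvd r" by (simp_all add: dvd_add_left_iff)
  then show "inflate p u (r + int p ^ Suc m) = inflate p u r"
    using f by (simp add: inflate_def is_step_def)
next
  fix x assume x: "x \<in> Qp p"
  consider "x \<in> disc N" | "x \<notin> disc N" "x \<in> disc (Suc N)" | "x \<notin> disc (Suc N)" "x \<notin> disc N"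
    using disc_mono[of N "Suc N"] by auto
  then show "f x = (if x \<in> disc (Suc N) then inflate p u (residue (Suc N) x (Suc m)) else 0)"
  proof cases
    case 1
    then have "x \<in> disc (Suc N)" using disc_mono[of N "Suc N"] by auto
    then show ?thesis using f x 1 by (simp add: is_step_def inflate_def residue_disc_Suc)
  next
    case 2
    then show ?thesis using f x in_disc_iff_dvd_residue[of x N m] by (simp add: is_step_def inflate_def)
  next
    case 3
    then show ?thesis using f x by (simp add: is_step_def)
  qed
qed

text \<open>Multiplication by \<open>p\<close> shifts digits, so the residues of \<open>p x\<close>
  in \<open>disc N\<close> are those of \<open>x\<close> in \<open>disc (Suc N)\<close>, and the
  sequence is unchanged.\<close>

lemma is_step_dilate: "is_step N m u f \<Longrightarrow> is_step (Suc N) m u (\<lambda>x. f (qp_ppow 1 x))"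
  by (simp add: is_step_def ppow_in_disc_iff residue_ppow)

lemma is_step_refine:
  assumes f: "is_step N m u f" and "m \<le> m'"
  shows "is_step N m' u f"
  unfolding is_step_def
proof (intro conjI allI ballI)
  fix r
  have "int p ^ m dvd int p ^ m'" using assms(2) by (rule le_imp_power_dvd)
  then have "(r + int p ^ m') mod int p ^ m = r mod int p ^ m" by auto
  then show "u (r + int p ^ m') = u r" using is_step_mod[OF f] by metis
next
  fix x assume x: "x \<in> Qp p"
  have "u (residue N x m) = u (residue N x m')"
    using is_step_mod[OF f, of "residue N x m'"] residue_mod[OF x assms(2)] by simp
  then show "f x = (if x \<in> disc N then u (residue N x m') else 0)"
    using f x by (simp add: is_step_def)
qed

lemma is_step_coarsen:
  assumes f: "is_step N m u f" and "m' \<le> m" and per: "\<And>r. u (r + int p ^ m') = u r"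
  shows "is_step N m' u f"
  unfolding is_step_def
proof (intro conjI allI ballI per)
  fix x assume x: "x \<in> Qp p"
  have "u (residue N x m) = u (residue N x m')"
    using periodic_int_mod[of u, OF per, of "residue N x m"] residue_mod[OF x assms(2)] by simp
  then show "f x = (if x \<in> disc N then u (residue N x m') else 0)"
    using f x by (simp add: is_step_def)
qed

section \<open>Integrals and inner products of step functions\<close>

lemma has_integral_residue:
  fixes w :: "int \<Rightarrow> 'b :: {banach, second_countable_topology}"
  shows "has_bochner_integral (haar p) (\<lambda>x. if x \<in> disc N then w (residue N x m) else 0)
    (real p powr (real N - real m) *\<^sub>R (\<Sum>r\<in>{0..<int p ^ m}. w r))"
proof -
  have "\<forall>r\<in>{0..<int p ^ m}. \<exists>z. z \<in> disc N \<and> residue N z m = r"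
    using ex_residue[of _ m N] by fastforce
  then obtain b where b: "\<And>r. r \<in> {0..<int p ^ m} \<Longrightarrow> b r \<in> disc N"
    "\<And>r. r \<in> {0..<int p ^ m} \<Longrightarrow> residue N (b r) m = r" by metis
  \<comment> \<open>The disc is partitioned by residues into \<open>p^m\<close> balls, each of
    measure \<open>p^(N - m)\<close>.\<close>
  define B where "B = (\<lambda>r. qball (int m - int N) (b r))"
  have B: "x \<in> B r \<longleftrightarrow> x \<in> disc N \<and> residue N x m = r" if r: "r \<in> {0..<int p ^ m}" for x r
  proof
    assume x: "x \<in> B r"
    then have xd: "x \<in> disc N" using b(1)[OF r] by (auto simp: B_def qball_def disc_def)
    then show "x \<in> disc N \<and> residue N x m = r"
      using x residue_eq_iff[OF xd b(1)[OF r], of m] b(2)[OF r] by (auto simp: B_def qball_def)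
  next
    assume x: "x \<in> disc N \<and> residue N x m = r"
    then show "x \<in> B r"
      using residue_eq_iff[of x N "b r" m] b[OF r] disc_subset_Qp by (auto simp: B_def qball_def)
  qed
  have "has_bochner_integral (haar p) (\<lambda>x. \<Sum>r\<in>{0..<int p ^ m}. indicator (B r) x *\<^sub>R w r)
    (\<Sum>r\<in>{0..<int p ^ m}. real p powr (real N - real m) *\<^sub>R w r)"
  proof (rule has_bochner_integral_sum)
    fix r assume r: "r \<in> {0..<int p ^ m}"
    have bQ: "b r \<in> Qp p" using b(1)[OF r] disc_subset_Qp by auto
    have "has_bochner_integral (haar p) (indicator (B r)) (measure (haar p) (B r))"
      unfolding B_def using emeasure_qball[OF bQ] by (intro has_bochner_integral_real_indicator) auto
    moreover have "measure (haar p) (B r) = real p powr (real N - real m)"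
      unfolding B_def using measure_qball[OF bQ] by simp
    ultimately show "has_bochner_integral (haar p) (\<lambda>x. indicator (B r) x *\<^sub>R w r) (real p powr (real N - real m) *\<^sub>R w r)"
      by (intro has_bochner_integral_scaleR_left) simp_all
  qed
  moreover have "(\<Sum>r\<in>{0..<int p ^ m}. indicator (B r) x *\<^sub>R w r) = (if x \<in> disc N then w (residue N x m) else 0)" for x
  proof (cases "x \<in> disc N")
    case True
    then have "x \<in> Qp p" using disc_subset_Qp by auto
    then have res: "residue N x m \<in> {0..<int p ^ m}" using residue_bounds by auto
    have "(\<Sum>r\<in>{0..<int p ^ m}. indicator (B r) x *\<^sub>R w r) = (\<Sum>r\<in>{0..<int p ^ m}. if r = residue N x m then w r else 0)"
      using B True by (intro sum.cong) (auto simp: indicator_def)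
    then show ?thesis using res True by simp
  next
    case False
    then have "(\<Sum>r\<in>{0..<int p ^ m}. indicator (B r) x *\<^sub>R w r) = 0"
      using B by (intro sum.neutral) (simp add: indicator_def)
    then show ?thesis using False by simp
  qed
  ultimately show ?thesis by (simp add: scaleR_sum_right)
qed

lemma is_step_L2:
  assumes f: "is_step N m u f"
  shows "f \<in> L2 p"
proof -
  define g where "g = (\<lambda>x. if x \<in> disc N then u (residue N x m) else 0)"
  have "g \<in> borel_measurable (haar p)"
    unfolding g_def using has_integral_residue[of N u m] by (auto simp: has_bochner_integral_iff)
  moreover have "(cmod (g x))\<^sup>2 = (if x \<in> disc N then (cmod (u (residue N x m)))\<^sup>2 else 0)" for x
    by (simp add: g_def)
  then have "integrable (haar p) (\<lambda>x. (cmod (g x))\<^sup>2)"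
    using has_integral_residue[of N "\<lambda>r. (cmod (u r))\<^sup>2" m] by (simp add: has_bochner_integral_iff)
  ultimately have "g \<in> L2 p" by (simp add: L2_def)
  then show ?thesis using f by (subst L2_cong[of f g]) (auto simp: is_step_def g_def)
qed

lemma is_step_inner:
  assumes f: "is_step N m u f" and g: "is_step N m v g"
  shows "l2inner p f g = of_real (real p powr (real N - real m)) * (\<Sum>r\<in>{0..<int p ^ m}. u r * cnj (v r))"
proof -
  have "l2inner p f g = (LINT x|haar p. (if x \<in> disc N then u (residue N x m) * cnj (v (residue N x m)) else 0))"
    unfolding l2inner_def using f g by (intro Bochner_Integration.integral_cong) (auto simp: is_step_def)
  also have "\<dots> = of_real (real p powr (real N - real m)) * (\<Sum>r\<in>{0..<int p ^ m}. u r * cnj (v r))"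
    using has_integral_residue[of N "\<lambda>r. u r * cnj (v r)" m]
    by (simp add: has_bochner_integral_iff scaleR_conv_of_real)
  finally show ?thesis .
qed

text \<open>The element of \<open>I\<^sub>p\<close> representing \<open>k / p\<^sup>N\<close>.\<close>
definition frac_elt :: "nat \<Rightarrow> nat \<Rightarrow> qp" where
  "frac_elt N k = (SOME z. z \<in> disc N \<and> (\<forall>i\<ge>0. z i = 0) \<and> residue N z N = int k)"

lemma frac_elt:
  assumes "k < p ^ N"
  shows "frac_elt N k \<in> disc N" "\<And>i. 0 \<le> i \<Longrightarrow> frac_elt N k i = 0" "residue N (frac_elt N k) N = int k"
proof -
  have "int k < int p ^ N" using assms by (metis of_nat_less_iff of_nat_power)
  then have "\<exists>z. z \<in> disc N \<and> (\<forall>i\<ge>0. z i = 0) \<and> residue N z N = int k"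
    using ex_residue[of "int k" N N] by fastforce
  then have "frac_elt N k \<in> disc N \<and> (\<forall>i\<ge>0. frac_elt N k i = 0) \<and> residue N (frac_elt N k) N = int k"
    unfolding frac_elt_def by (rule someI_ex)
  then show "frac_elt N k \<in> disc N" "\<And>i. 0 \<le> i \<Longrightarrow> frac_elt N k i = 0" "residue N (frac_elt N k) N = int k"
    by auto
qed

section \<open>Translates by elements of \<open>Ip p\<close>\<close>

lemma Ip_iff: "a \<in> Ip p \<longleftrightarrow> a \<in> Qp p \<and> (\<forall>k\<ge>0. a k = 0)"
  unfolding Ip_def qp_frac_def fun_eq_iff by (auto simp: not_less)

lemma residue_Ip:
  assumes "a \<in> Ip p" "N \<le> m"
  shows "residue N a m = residue N a N"
  using assms(2)
proof (induction m rule: dec_induct)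
  case (step n)
  then show ?case using assms(1) by (simp add: residue_Suc Ip_iff)
qed simp

lemma frac_elt_in_Ip: "k < p ^ N \<Longrightarrow> frac_elt N k \<in> Ip p"
  using frac_elt(1,2)[of k N] disc_subset_Qp[of N] by (auto simp: Ip_iff)

lemma residue_frac_elt: "k < p ^ N \<Longrightarrow> N \<le> m \<Longrightarrow> residue N (frac_elt N k) m = int k"
  by (rule trans[OF residue_Ip[OF frac_elt_in_Ip] frac_elt(3)])

lemma frac_elt_eq_iff: "k < p ^ N \<Longrightarrow> l < p ^ N \<Longrightarrow> frac_elt N k = frac_elt N l \<longleftrightarrow> k = l"
  by (metis frac_elt(3) of_nat_eq_iff)

lemma is_step_transl_frac_elt:
  assumes "is_step N m u f" "k < p ^ N" "N \<le> m"
  shows "is_step N m (\<lambda>r. u (r - int k)) (qp_transl p (frac_elt N k) f)"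
  using is_step_transl[OF assms(1) frac_elt(1)[OF assms(2)]] residue_frac_elt[OF assms(2,3)] by simp

text \<open>By \<open>is_step_inner\<close>, inner products are sums over one period with weight
  \<open>p^(N - m)\<close>; the weight moves to the other side.\<close>

lemma is_step_orthogonality:
  assumes f: "is_step N m u f" and "N \<le> m"
    and orth: "\<forall>a\<in>Ip p. \<forall>b\<in>Ip p. l2inner p (qp_transl p a f) (qp_transl p b f) = (if a = b then 1 else 0)"
    and kl: "k < p ^ N" "l < p ^ N"
  shows "(\<Sum>r\<in>{0..<int p ^ m}. u (r - int k) * cnj (u (r - int l))) =
    (if k = l then of_real (real p powr (real m - real N)) else 0)"
proof -
  let ?S = "\<Sum>r\<in>{0..<int p ^ m}. u (r - int k) * cnj (u (r - int l))"
  have "of_real (real p powr (real N - real m)) * ?S = (if k = l then 1 else 0)"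
    using orth kl frac_elt_in_Ip frac_elt_eq_iff[OF kl]
      is_step_inner[OF is_step_transl_frac_elt[OF f kl(1) assms(2)] is_step_transl_frac_elt[OF f kl(2) assms(2)]]
    by simp
  then have "of_real (real p powr (real m - real N)) * (of_real (real p powr (real N - real m)) * ?S) =
    of_real (real p powr (real m - real N)) * (if k = l then 1 else 0)" by simp
  moreover have "real p powr (real m - real N) * real p powr (real N - real m) = 1"
    by (simp flip: powr_add)
  ultimately show ?thesis by (simp add: mult.assoc[symmetric] flip: of_real_mult)
qed

text \<open>Elements of \<open>Ip p\<close> have no digits at nonnegative positions, so those in the
  disc act as integer shifts below \<open>p^N\<close>; all other translates vanish on the
  disc.\<close>

lemma cspan_transl_on_disc:
  assumes f: "is_step N m u f" and "N \<le> m" and h: "h \<in> cspan {qp_transl p a f | a. a \<in> Ip p}"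
  shows "\<exists>c. \<forall>x\<in>disc N. h x = (\<Sum>j<p ^ N. c j * u (residue N x m - int j))"
proof -
  define V where "V = {h. \<exists>c. \<forall>x\<in>disc N. h x = (\<Sum>j<p ^ N. c j * u (residue N x m - int j))}"
  have "csubspace V"
    unfolding csubspace_def
  proof (intro conjI ballI allI)
    show "(\<lambda>x. 0) \<in> V" unfolding V_def by (auto intro!: exI[of _ "\<lambda>_. 0"])
  next
    fix h1 h2 assume "h1 \<in> V" "h2 \<in> V"
    then obtain c1 c2 where "\<forall>x\<in>disc N. h1 x = (\<Sum>j<p ^ N. c1 j * u (residue N x m - int j))"
      "\<forall>x\<in>disc N. h2 x = (\<Sum>j<p ^ N. c2 j * u (residue N x m - int j))" by (auto simp: V_def)
    then show "(\<lambda>x. h1 x + h2 x) \<in> V"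
      by (auto simp: V_def sum.distrib distrib_right intro!: exI[of _ "\<lambda>j. c1 j + c2 j"])
  next
    fix a h1 assume "h1 \<in> V"
    then obtain c1 where "\<forall>x\<in>disc N. h1 x = (\<Sum>j<p ^ N. c1 j * u (residue N x m - int j))" by (auto simp: V_def)
    then show "(\<lambda>x. a * h1 x) \<in> V"
      by (auto simp: V_def sum_distrib_left mult.assoc intro!: exI[of _ "\<lambda>j. a * c1 j"])
  qed
  moreover have "{qp_transl p a f | a. a \<in> Ip p} \<subseteq> V"
  proof
    fix g assume "g \<in> {qp_transl p a f | a. a \<in> Ip p}"
    then obtain a where a: "a \<in> Ip p" and g: "g = qp_transl p a f" by auto
    have aQ: "a \<in> Qp p" using a by (simp add: Ip_iff)
    show "g \<in> V"
    proof (cases "a \<in> disc N")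
      case True
      define k where "k = nat (residue N a N)"
      have res: "residue N a N = int k" using residue_bounds[OF aQ] by (simp add: k_def)
      then have k: "k < p ^ N" using residue_bounds(2)[OF aQ, of N N]
        by (metis of_nat_less_iff of_nat_power)
      have "g x = (\<Sum>j<p ^ N. (if j = k then 1 else 0) * u (residue N x m - int j))" if x: "x \<in> disc N" for x
      proof -
        have "(\<Sum>j<p ^ N. (if j = k then 1 else 0) * u (residue N x m - int j)) =
            (\<Sum>j<p ^ N. if j = k then u (residue N x m - int j) else 0)" by (intro sum.cong) auto
        then have "(\<Sum>j<p ^ N. (if j = k then 1 else 0) * u (residue N x m - int j)) = u (residue N x m - int k)"
          using k by simp
        moreover have "g x = u (residue N x m - residue N a m)"
          using is_step_transl[OF f True] x disc_subset_Qp[of N] by (auto simp: is_step_def g)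
        ultimately show ?thesis using residue_Ip[OF a assms(2)] res by simp
      qed
      then show ?thesis unfolding V_def by (auto intro!: exI[of _ "\<lambda>j. if j = k then 1 else 0"])
    next
      case False
      then have "\<forall>x\<in>disc N. g x = 0" using is_step_transl_eq_0[OF f aQ] by (simp add: g)
      then show ?thesis unfolding V_def by (auto intro!: exI[of _ "\<lambda>_. 0"])
    qed
  qed
  ultimately have "cspan {qp_transl p a f | a. a \<in> Ip p} \<subseteq> V" by (rule cspan_minimal)
  then show ?thesis using h by (auto simp: V_def)
qed

text \<open>A translation may move the support out of \<open>disc N\<close>, so
  \<open>is_step_inflate\<close> first enlarges the disc until it contains \<open>a\<close>.\<close>

lemma transl_subset_L2:
  assumes f: "is_step N m u f"
  shows "{qp_transl p a f | a. a \<in> Qp p} \<subseteq> L2 p"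
proof
  fix g assume "g \<in> {qp_transl p a f | a. a \<in> Qp p}"
  then obtain a where a: "a \<in> Qp p" and g: "g = qp_transl p a f" by auto
  obtain M m' u' where M: "a \<in> disc M" "is_step M m' u' f"
  proof -
    obtain M where M: "a \<in> disc M" "N \<le> M" using Qp_ex_disc[OF a] .
    have "\<exists>m u. is_step M m u f" using M(2)
    proof (induction M rule: dec_induct)
      case base
      then show ?case using f by blast
    next
      case (step M)
      then show ?case using is_step_inflate by blast
    qed
    then show ?thesis using M that by blast
  qed
  show "g \<in> L2 p" unfolding g by (rule is_step_L2[OF is_step_transl[OF M(2,1)]])
qed

text \<open>Translates by elements outside the disc vanish on the disc, so that on the disc the closed span
  of all translates reduces to a finite-dimensional space.\<close>
lemma is_step_refinement:
  assumes f: "is_step N m u f" and "N \<le> m"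
    and orth: "\<forall>a\<in>Ip p. \<forall>b\<in>Ip p. l2inner p (qp_transl p a f) (qp_transl p b f) = (if a = b then 1 else 0)"
    and g: "is_step N m v g" "g \<in> l2_closure p (cspan {qp_transl p a f | a. a \<in> Ip p})"
  shows "\<exists>c. \<forall>r. v r = (\<Sum>j<p ^ N. c j * u (r - int j))"
proof -
  define S where "S = {qp_transl p a f | a. a \<in> Ip p}"
  have S: "cspan S \<subseteq> L2 p"
    using transl_subset_L2[OF f] by (intro cspan_subset_L2) (auto simp: S_def Ip_iff)
  define C where "C = real p powr (real N - real m)"
  have C: "0 < C" by (simp add: C_def)
  have "\<exists>c. \<forall>r\<in>{0..<int p ^ m}. v r = (\<Sum>j<p ^ N. c j * u (r - int j))"
  proof (rule orthogonal_span_closed)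
    show "(\<Sum>r\<in>{0..<int p ^ m}. u (r - int k) * cnj (u (r - int l))) =
      (if k = l then of_real (real p powr (real m - real N)) else 0)" if "k < p ^ N" "l < p ^ N" for k l
      using is_step_orthogonality[OF f assms(2) orth that] .
    fix e :: real assume e: "0 < e"
    then have "0 < C * e" using C by simp
    then obtain h where h: "h \<in> cspan S" "l2sq (\<lambda>x. g x - h x) < C * e"
      using g(2) unfolding l2_closure_iff S_def by blast
    obtain c where c: "\<forall>x\<in>disc N. h x = (\<Sum>j<p ^ N. c j * u (residue N x m - int j))"
      using cspan_transl_on_disc[OF f assms(2)] h(1) unfolding S_def by blast
    define F where "F = (\<lambda>r. (cmod (v r - (\<Sum>j<p ^ N. c j * u (r - int j))))\<^sup>2)"
    have L: "g \<in> L2 p" "h \<in> L2 p" using is_step_L2[OF g(1)] h(1) S by auto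
    \<comment> \<open>On the disc the squared L2 distance is, up to the weight \<open>C\<close>, the
      discrete squared distance over one period.\<close>
    have "C * (\<Sum>r\<in>{0..<int p ^ m}. F r) = (LINT x|haar p. (if x \<in> disc N then F (residue N x m) else 0))"
      using has_integral_residue[of N F m] by (simp add: has_bochner_integral_iff C_def)
    also have "\<dots> = l2sq (\<lambda>x. indicator (disc N) x * (g x - h x))"
      unfolding l2sq_def
    proof (intro Bochner_Integration.integral_cong refl)
      fix x assume "x \<in> space (haar p)"
      then show "(if x \<in> disc N then F (residue N x m) else 0) = (cmod (indicator (disc N) x * (g x - h x)))\<^sup>2"
        using g(1) c by (auto simp: is_step_def F_def indicator_def)
    qed
    also have "\<dots> \<le> l2sq (\<lambda>x. g x - h x)"
      by (intro l2sq_mult_indicator_le L2_diff L disc_sets)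
    also have "\<dots> < C * e" by (rule h(2))
    finally show "\<exists>c. (\<Sum>r\<in>{0..<int p ^ m}. (cmod (v r - (\<Sum>j<p ^ N. c j * u (r - int j))))\<^sup>2) < e"
      using C by (auto simp: F_def)
  qed auto
  then obtain c where c: "\<And>r. r \<in> {0..<int p ^ m} \<Longrightarrow> v r = (\<Sum>j<p ^ N. c j * u (r - int j))" by blast
  \<comment> \<open>Both sides are periodic, so the identity extends from one period to all
    integers.\<close>
  have "v r = (\<Sum>j<p ^ N. c j * u (r - int j))" for r
  proof -
    have "v r = v (r mod int p ^ m)" using is_step_mod[OF g(1)] by simp
    also have "\<dots> = (\<Sum>j<p ^ N. c j * u (r mod int p ^ m - int j))" by (intro c) simp
    also have "\<dots> = (\<Sum>j<p ^ N. c j * u (r - int j))"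
    proof (intro sum.cong refl arg_cong2[where f = "(*)"])
      fix j
      have "(r mod int p ^ m - int j) mod int p ^ m = (r - int j) mod int p ^ m" by (simp add: mod_simps)
      then show "u (r mod int p ^ m - int j) = u (r - int j)" using is_step_mod[OF f] by metis
    qed
    finally show ?thesis .
  qed
  then show ?thesis by blast
qed


section \<open>Test functions and uniqueness\<close>

lemma qp_norm_leading:
  assumes x: "x \<in> Qp p" and nz: "x k \<noteq> 0"
  obtains g where "x g \<noteq> 0" "\<forall>i<g. x i = 0" "qp_norm p x = real p powr (- real_of_int g)"
proof -
  obtain K where K: "\<forall>i<K. x i = 0" using x by (auto simp: Qp_def)
  define n where "n = (LEAST n. x (K + int n) \<noteq> 0)"
  define g where "g = K + int n"
  have "K \<le> k" using K nz by (meson not_less)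
  then have "x (K + int (nat (k - K))) \<noteq> 0" using nz by simp
  then have g: "x g \<noteq> 0" unfolding g_def n_def by (rule LeastI)
  have below: "\<forall>i<g. x i = 0"
  proof (intro allI impI)
    fix i assume i: "i < g"
    show "x i = 0"
    proof (cases "i < K")
      case False
      then have "nat (i - K) < n" "i = K + int (nat (i - K))" using i by (auto simp: g_def)
      then show ?thesis
        using not_less_Least[of "nat (i - K)" "\<lambda>n. x (K + int n) \<noteq> 0"] by (simp add: n_def)
    qed (use K in simp)
  qed
  have "(THE g. x g \<noteq> 0 \<and> (\<forall>i<g. x i = 0)) = g"
  proof (rule the_equality)
    show "h = g" if "x h \<noteq> 0 \<and> (\<forall>i<h. x i = 0)" for h
      using that g below by (cases h g rule: linorder_cases) auto
  qed (use g below in simp)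
  then have "qp_norm p x = real p powr (- real_of_int g)" using g by (auto simp: qp_norm_def)
  then show ?thesis using that g below by blast
qed

lemma qp_norm_le:
  assumes x: "x \<in> Qp p" and zero: "\<forall>i<n. x i = 0"
  shows "qp_norm p x \<le> real p powr (- real_of_int n)"
proof (cases "\<exists>k. x k \<noteq> 0")
  case True
  then obtain k where "x k \<noteq> 0" by blast
  with x obtain g where g: "x g \<noteq> 0" "qp_norm p x = real p powr (- real_of_int g)"
    by (rule qp_norm_leading)
  have "n \<le> g" using zero g(1) by (meson not_less)
  then show ?thesis unfolding g(2) using p_gt_1 by (intro powr_mono) auto
next
  case False
  then show ?thesis by (simp add: qp_norm_def)
qed

text \<open>The nonzero values of the norm are integral powers of \<open>p\<close>, so a strict
  bound gains one position: the digit at \<open>n\<close> itself vanishes too.\<close>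

lemma qp_norm_less_imp_zero:
  assumes x: "x \<in> Qp p" and less: "qp_norm p x < real p powr (- real_of_int n)" and k: "k \<le> n"
  shows "x k = 0"
proof (rule ccontr)
  assume "x k \<noteq> 0"
  with x obtain g where g: "\<forall>i<g. x i = 0" "qp_norm p x = real p powr (- real_of_int g)"
    by (rule qp_norm_leading)
  have "g \<le> k" using g(1) \<open>x k \<noteq> 0\<close> by (meson not_less)
  then have "real p powr (- real_of_int n) \<le> real p powr (- real_of_int g)"
    using k p_gt_1 by (intro powr_mono) auto
  then show False using less g(2) by simp
qed

lemma not_in_disc_imp_norm_gt:
  assumes x: "x \<in> Qp p" "x \<notin> disc N"
  shows "real p ^ N < qp_norm p x"
proof -
  obtain k where k: "k < - int N" "x k \<noteq> 0" using x by (auto simp: disc_def)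
  obtain g where g: "\<forall>i<g. x i = 0" "qp_norm p x = real p powr (- real_of_int g)"
    using x(1) k(2) by (rule qp_norm_leading)
  have "g \<le> k" using g(1) k(2) by (meson not_less)
  then have "real p powr real N < real p powr (- real_of_int g)"
    using k p_gt_1 by (intro powr_less_mono) auto
  then show ?thesis using g(2) by (simp add: powr_realpow)
qed

text \<open>Koenig's lemma: a ball on which \<open>f\<close> is not uniformly locally
  constant contains a ball of the next level with the same defect.\<close>
lemma locally_constant_uniform:
  assumes lc: "\<forall>x\<in>Qp p. \<exists>n. \<forall>y\<in>Qp p. (\<forall>k<n. y k = x k) \<longrightarrow> f y = f x"
  shows "\<exists>m. \<forall>x\<in>disc N. \<forall>y\<in>disc N. (\<forall>k<m. x k = y k) \<longrightarrow> f x = f y"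
proof (rule ccontr)
  assume contra: "\<not> ?thesis"
  define bad where "bad = (\<lambda>j b. b \<in> disc N \<and>
    (\<forall>m. \<exists>x\<in>qball j b. \<exists>y\<in>qball j b. (\<forall>k<m. x k = y k) \<and> f x \<noteq> f y))"
  \<comment> \<open>The ball of level \<open>- N\<close> about zero is the whole disc;
    \<open>int 0 - int N\<close> is the form needed to start the sequence of choices.\<close>
  have start: "bad (int 0 - int N) qp_zero"
    using contra unfolding bad_def disc_eq_qball[symmetric] by (auto simp: disc_eq_qball[symmetric])
  have refine: "\<exists>b'. bad (j + 1) b' \<and> (\<forall>k<j. b' k = b k)" if b: "bad j b" and j: "- int N \<le> j" for j b
  proof (rule ccontr)
    assume none: "\<not> ?thesis"
    have bN: "b \<in> disc N" using b by (simp add: bad_def)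
    then have bQ: "b \<in> Qp p" using disc_subset_Qp by auto
    have "\<exists>m. \<forall>x\<in>qball (j + 1) (b(j := c)). \<forall>y\<in>qball (j + 1) (b(j := c)).
      (\<forall>k<m. x k = y k) \<longrightarrow> f x = f y" if c: "c < p" for c
    proof -
      have "b(j := c) \<in> disc N" using bN fun_upd_in_Qp[OF bQ c] j by (auto simp: disc_def)
      moreover have "\<not> bad (j + 1) (b(j := c))" using none by auto
      ultimately show ?thesis unfolding bad_def by blast
    qed
    then obtain m where m: "\<And>c x y. \<lbrakk>c < p; x \<in> qball (j + 1) (b(j := c)); y \<in> qball (j + 1) (b(j := c));
      \<forall>k<m c. x k = y k\<rbrakk> \<Longrightarrow> f x = f y" by metis
    \<comment> \<open>A threshold serving all \<open>p\<close> subballs; including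
      \<open>j + 1\<close> makes \<open>x\<close> and \<open>y\<close> agree at \<open>j\<close>,
      hence lie in the same subball.\<close>
    define M where "M = Max (insert (j + 1) (m ` {..<p}))"
    have M: "j + 1 \<le> M" "\<And>c. c < p \<Longrightarrow> m c \<le> M" by (auto simp: M_def)
    obtain x y where xy: "x \<in> qball j b" "y \<in> qball j b" "\<forall>k<M. x k = y k" "f x \<noteq> f y"
      using b unfolding bad_def by blast
    have "x j < p" using xy(1) by (auto simp: qball_def Qp_def)
    moreover have "x j = y j" using xy(3) M(1) by simp
    then have "x \<in> qball (j + 1) (b(j := x j))" "y \<in> qball (j + 1) (b(j := x j))"
      using xy(1,2) by (auto simp: qball_def)
    moreover have "\<forall>k<m (x j). x k = y k" using xy(3) M(2)[OF \<open>x j < p\<close>] by auto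
    ultimately show False using m xy(4) by blast
  qed
  have "\<exists>b. \<forall>i. bad (int i - int N) (b i) \<and> (\<forall>k<int i - int N. b (Suc i) k = b i k)"
  proof (rule dependent_nat_choice)
    show "\<exists>b. bad (int 0 - int N) b" using start by blast
    show "\<exists>b'. bad (int (Suc i) - int N) b' \<and> (\<forall>k<int i - int N. b' k = b k)"
      if "bad (int i - int N) b" for b i
      using refine[OF that] by (simp add: algebra_simps)
  qed
  then obtain b where b: "\<And>i. bad (int i - int N) (b i)"
    "\<And>i k. k < int i - int N \<Longrightarrow> b (Suc i) k = b i k" by blast
  have stable: "b i' k = b i k" if "k < int i - int N" "i \<le> i'" for i i' k
    using that(2)
  proof (induction i' rule: dec_induct)
    case (step n)
    then show ?case using b(2)[of k n] that(1) by simp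
  qed simp
  \<comment> \<open>The limit point takes each digit from a stage at which it is already
    fixed.\<close>
  define x where "x = (\<lambda>k. if k < - int N then 0 else b (nat (k + int N + 1)) k)"
  have bN: "b i \<in> disc N" for i using b(1) by (simp add: bad_def)
  have xb: "x k = b i k" if "k < int i - int N" for i k
  proof (cases "k < - int N")
    case True
    then show ?thesis using bN[of i] by (simp add: x_def disc_def)
  next
    case False
    then show ?thesis using that stable[of k "nat (k + int N + 1)" i] by (simp add: x_def)
  qed
  have "x k < p" for k
    using xb[of k "nat (k + int N + 1)"] bN[of "nat (k + int N + 1)"] disc_subset_Qp
    by (auto simp: x_def Qp_def)
  then have xQ: "x \<in> Qp p" by (auto simp: Qp_def x_def intro!: exI[of _ "- int N"])
  obtain n where n: "\<forall>y\<in>Qp p. (\<forall>k<n. y k = x k) \<longrightarrow> f y = f x" using lc xQ by blast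
  define i where "i = nat (n + int N)"
  have "n \<le> int i - int N" by (simp add: i_def)
  then have "f y = f x" if "y \<in> qball (int i - int N) (b i)" for y
    using that n xb[of _ i] by (auto simp: qball_def)
  then show False using b(1)[of i] unfolding bad_def by metis
qed

text \<open>Bounded support gives the disc and uniform local constancy gives the level
  \<open>m\<close>; the sequence is read off at chosen representatives of the residues.\<close>

lemma qp_test_imp_is_step:
  assumes f: "qp_test p f"
  shows "\<exists>N m u. N \<le> m \<and> is_step N m u f"
proof -
  have "\<exists>n. \<forall>y\<in>Qp p. (\<forall>k<n. y k = x k) \<longrightarrow> f y = f x" if x: "x \<in> Qp p" for x
  proof -
    obtain e where e: "0 < e" "\<forall>y\<in>Qp p. qp_norm p (qp_sub p y x) < e \<longrightarrow> f y = f x"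
      using f x by (auto simp: qp_test_def)
    obtain n where n: "1 / e < real p ^ n" using real_arch_pow[of "real p" "1 / e"] p_gt_1 by auto
    have small: "real p powr (- real n) < e"
      using n e(1) by (simp add: powr_minus powr_realpow field_simps)
    have "f y = f x" if y: "y \<in> Qp p" "\<forall>k<int n. y k = x k" for y
    proof -
      have "\<forall>k<int n. qp_sub p y x k = 0" using qp_sub_digits_zero_iff[OF y(1) x] y(2) by blast
      then have "qp_norm p (qp_sub p y x) \<le> real p powr (- real n)"
        using qp_norm_le[OF qp_sub_in_Qp[OF y(1) x], of "int n"] by simp
      then show ?thesis using e(2) y(1) small by auto
    qed
    then show ?thesis by blast
  qed
  then have lc: "\<forall>x\<in>Qp p. \<exists>n. \<forall>y\<in>Qp p. (\<forall>k<n. y k = x k) \<longrightarrow> f y = f x" by blast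
  obtain R where R: "\<forall>x\<in>Qp p. R < qp_norm p x \<longrightarrow> f x = 0" using f by (auto simp: qp_test_def)
  obtain N where N: "R < real p ^ N" using real_arch_pow[of "real p" R] p_gt_1 by auto
  have outside: "f x = 0" if "x \<in> Qp p" "x \<notin> disc N" for x
    using not_in_disc_imp_norm_gt[OF that] N R that(1) by auto
  obtain m0 where m0: "\<forall>x\<in>disc N. \<forall>y\<in>disc N. (\<forall>k<m0. x k = y k) \<longrightarrow> f x = f y"
    using locally_constant_uniform[OF lc] by blast
  \<comment> \<open>This makes \<open>m - N\<close> at least \<open>m0\<close> and secures
    \<open>N \<le> m\<close>.\<close>
  define m where "m = N + nat m0"
  have agree: "f x = f y" if "x \<in> disc N" "y \<in> disc N" "residue N x m = residue N y m" for x y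
  proof -
    have "\<forall>k<int m - int N. x k = y k" using that residue_eq_iff by blast
    then have "\<forall>k<m0. x k = y k" by (auto simp: m_def)
    then show ?thesis using m0 that by blast
  qed
  \<comment> \<open>Reducing \<open>r\<close> before choosing the representative makes the sequence
    periodic.\<close>
  define E where "E = (\<lambda>r. SOME z. z \<in> disc N \<and> residue N z m = r mod int p ^ m)"
  have E: "E r \<in> disc N \<and> residue N (E r) m = r mod int p ^ m" for r
  proof -
    have "\<exists>z. z \<in> disc N \<and> residue N z m = r mod int p ^ m"
      using ex_residue[of "r mod int p ^ m" m N] by fastforce
    then show ?thesis unfolding E_def by (rule someI_ex)
  qed
  have "is_step N m (\<lambda>r. f (E r)) f"
    unfolding is_step_def
  proof (intro conjI allI ballI)
    fix r show "f (E (r + int p ^ m)) = f (E r)" by (simp add: E_def)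
  next
    fix x assume x: "x \<in> Qp p"
    show "f x = (if x \<in> disc N then f (E (residue N x m)) else 0)"
    proof (cases "x \<in> disc N")
      case True
      have "residue N (E (residue N x m)) m = residue N x m"
        using E residue_mod[OF x order.refl] by simp
      then show ?thesis using agree[OF True, of "E (residue N x m)"] E True by simp
    qed (use outside x in simp)
  qed
  then show ?thesis by (intro exI[of _ N] exI[of _ m]) (auto simp: m_def)
qed

section \<open>Step functions constant on unit balls\<close>

lemma is_step_square_raise:
  assumes f: "is_step N N u f"
  shows "N \<le> M \<Longrightarrow> \<exists>u. is_step M M u f"
proof (induction M rule: dec_induct)
  case base
  then show ?case using f by blast
next
  case (step M)
  then show ?case using is_step_inflate by blast
qed

lemma is_step_square_disc:
  assumes f: "is_step N N u f" and b: "b \<in> Qp p"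
  obtains M v where "b \<in> disc M" "is_step M M v f"
proof -
  obtain M where M: "b \<in> disc M" "N \<le> M" using Qp_ex_disc[OF b] .
  then show ?thesis using is_step_square_raise[OF f, of M] that by blast
qed

lemma qball_0_iff_residue:
  assumes x: "x \<in> disc N" and b: "b \<in> disc N"
  shows "x \<in> qball 0 b \<longleftrightarrow> residue N x N = residue N b N"
  using residue_eq_iff[OF x b, of N] x disc_subset_Qp by (auto simp: qball_def)

text \<open>With \<open>m = N\<close> the step function is constant on unit balls, and its support
  lies in the \<open>p^N\<close> unit balls that make up the disc.\<close>

lemma is_step_in_haar_space:
  assumes f: "is_step N N u f"
  shows "f \<in> haar_space 0"
proof -
  have "(\<lambda>x. \<Sum>k<p ^ N. u (int k) * indicator (qball 0 (frac_elt N k)) x) \<in> haar_space 0"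
    using frac_elt(1) disc_subset_Qp
    by (intro csubspace_sum csubspace_haar_space indicator_qball_in_haar_space) blast
  then show ?thesis
    unfolding haar_space_def
  proof (rule l2_closure_cong)
    fix x assume x: "x \<in> Qp p"
    show "(\<Sum>k<p ^ N. u (int k) * indicator (qball 0 (frac_elt N k)) x) = f x"
    proof (cases "x \<in> disc N")
      case True
      define r where "r = nat (residue N x N)"
      have r: "residue N x N = int r" using residue_bounds(1)[OF x] by (simp add: r_def)
      then have rn: "r < p ^ N" using residue_bounds(2)[OF x, of N N] by (metis of_nat_less_iff of_nat_power)
      have "(\<Sum>k<p ^ N. u (int k) * indicator (qball 0 (frac_elt N k)) x) = (\<Sum>k<p ^ N. if k = r then u (int k) else 0)"
        using r frac_elt(1,3) qball_0_iff_residue[OF True] by (intro sum.cong) (auto simp: indicator_def)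
      then show ?thesis using f x True r rn by (simp add: is_step_def)
    next
      case False
      have "x \<notin> qball 0 (frac_elt N k)" if "k < p ^ N" for k
      proof
        assume "x \<in> qball 0 (frac_elt N k)"
        then have "x \<in> disc N" using frac_elt(1)[OF that] by (auto simp: qball_def disc_def)
        then show False using False by simp
      qed
      then have "(\<Sum>k<p ^ N. u (int k) * indicator (qball 0 (frac_elt N k)) x) = 0"
        by (intro sum.neutral) auto
      then show ?thesis using f x False by (simp add: is_step_def)
    qed
  qed
qed

text \<open>Since the shifts of \<open>u\<close> are the rows of a unitary matrix, so are its columns: this expresses
  the indicator of a ball by translates of \<open>f\<close>.\<close>
lemma qball_indicator_in_transl_span:
  assumes f: "is_step N N u f" and b: "b \<in> disc N"
    and orth: "\<forall>a\<in>Ip p. \<forall>b\<in>Ip p. l2inner p (qp_transl p a f) (qp_transl p b f) = (if a = b then 1 else 0)"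
  shows "indicator (qball 0 b) \<in> l2_closure p (cspan {qp_transl p a f | a. a \<in> Ip p})"
proof -
  define S where "S = {qp_transl p a f | a. a \<in> Ip p}"
  have S: "cspan S \<subseteq> L2 p"
    using transl_subset_L2[OF f] by (intro cspan_subset_L2) (auto simp: S_def Ip_iff)
  define n where "n = p ^ N"
  have n: "0 < n" "int p ^ N = int n" by (simp_all add: n_def)
  have per: "u (r + int n) = u r" for r using f n(2) by (simp add: is_step_def)
  have bQ: "b \<in> Qp p" using b disc_subset_Qp by auto
  \<comment> \<open>For \<open>m = N\<close> the normalising factor is 1.\<close>
  have rows: "(\<Sum>r\<in>{0..<int n}. u (r - int k) * cnj (u (r - int l))) = (if k = l then 1 else 0)"
    if "k < n" "l < n" for k l
    using is_step_orthogonality[OF f order.refl orth that[unfolded n_def]] by (simp add: n(2))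
  \<comment> \<open>The matrix is circulant: reversing and shifting the summation turns a product of
    columns \<open>k\<close> and \<open>l\<close> into a product of the rows with indices
    \<open>(l - k) mod n\<close> and 0.\<close>
  have columns: "(\<Sum>j<n. cnj (u (l - int j)) * u (k - int j)) = (if k = l then 1 else 0)"
    if k: "0 \<le> k" "k < int n" and l: "0 \<le> l" "l < int n" for k l
  proof -
    define F where "F = (\<lambda>s. u (k + s) * cnj (u (l + s)))"
    have F_per: "F (s + int n) = F s" for s
      using per[of "k + s"] per[of "l + s"] by (simp add: F_def algebra_simps)
    have "(\<Sum>j<n. cnj (u (l - int j)) * u (k - int j)) = (\<Sum>j\<in>{0..<int n}. F (- j))"
      by (rule sum.reindex_bij_witness[where i = nat and j = int]) (auto simp: F_def)
    also have "\<dots> = (\<Sum>j\<in>{0..<int n}. F (j - (int n - 1)))"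
      by (rule sum.reindex_bij_witness[where i = "\<lambda>j. int n - 1 - j" and j = "\<lambda>j. int n - 1 - j"]) auto
    also have "\<dots> = (\<Sum>j\<in>{0..<int n}. F j)"
      by (rule sum_periodic_shift[of n F, OF n(1) F_per])
    also have "\<dots> = (\<Sum>j\<in>{0..<int n}. F (j - l))"
      by (rule sum_periodic_shift[of n F, OF n(1) F_per, symmetric])
    also have "\<dots> = (\<Sum>j\<in>{0..<int n}. u (j - int (nat ((l - k) mod int n))) * cnj (u (j - int 0)))"
    proof (intro sum.cong refl)
      fix j
      have "u (j - (l - k) mod int n) = u ((j - (l - k) mod int n) mod int n)"
        using periodic_int_mod[of u "int n", OF per] by simp
      also have "(j - (l - k) mod int n) mod int n = (k + (j - l)) mod int n"
        by (simp add: mod_simps algebra_simps)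
      also have "u \<dots> = u (k + (j - l))" by (rule periodic_int_mod[of u "int n", OF per])
      finally show "F (j - l) = u (j - int (nat ((l - k) mod int n))) * cnj (u (j - int 0))"
        using n(1) by (simp add: F_def)
    qed
    also have "\<dots> = (if nat ((l - k) mod int n) = 0 then 1 else 0)"
      using n(1) by (intro rows) (auto simp: nat_less_iff)
    also have "nat ((l - k) mod int n) = 0 \<longleftrightarrow> k = l"
    proof -
      have "(l - k) mod int n = 0 \<longleftrightarrow> l mod int n = k mod int n"
        by (simp add: mod_eq_dvd_iff dvd_eq_mod_eq_0)
      moreover have "nat t = 0 \<longleftrightarrow> t = 0" if "0 \<le> t" for t :: int using that by auto
      moreover have "0 \<le> (l - k) mod int n" using n(1) by simp
      moreover have "l mod int n = l" "k mod int n = k" using k l by simp_all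
      ultimately show ?thesis by metis
    qed
    finally show ?thesis .
  qed
  define \<beta> where "\<beta> = residue N b N"
  have "(\<lambda>x. \<Sum>j<n. cnj (u (\<beta> - int j)) * qp_transl p (frac_elt N j) f x) \<in> cspan S"
  proof (intro csubspace_sum csubspace_cspan)
    fix j assume "j \<in> {..<n}"
    then have "frac_elt N j \<in> Ip p" by (intro frac_elt_in_Ip) (simp add: n_def)
    then show "qp_transl p (frac_elt N j) f \<in> cspan S" using cspan_superset[of S] by (auto simp: S_def)
  qed
  then have "(\<lambda>x. \<Sum>j<n. cnj (u (\<beta> - int j)) * qp_transl p (frac_elt N j) f x) \<in> l2_closure p (cspan S)"
    using l2_closure_superset[OF S] by blast
  then show ?thesis
    unfolding S_def
  proof (rule l2_closure_cong)
    fix x assume x: "x \<in> Qp p"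
    have transl: "qp_transl p (frac_elt N j) f x = (if x \<in> disc N then u (residue N x N - int j) else 0)"
      if "j < n" for j
      using is_step_transl_frac_elt[OF f _ order.refl, of j] that x by (simp add: is_step_def n_def)
    show "(\<Sum>j<n. cnj (u (\<beta> - int j)) * qp_transl p (frac_elt N j) f x) = indicator (qball 0 b) x"
    proof (cases "x \<in> disc N")
      case True
      have "(\<Sum>j<n. cnj (u (\<beta> - int j)) * qp_transl p (frac_elt N j) f x) =
        (\<Sum>j<n. cnj (u (\<beta> - int j)) * u (residue N x N - int j))"
        using True transl by (intro sum.cong) auto
      also have "\<dots> = (if residue N x N = \<beta> then 1 else 0)"
        using residue_bounds[OF x, of N N] residue_bounds[OF bQ, of N N] n(2)
        by (intro columns) (auto simp: \<beta>_def)
      finally show ?thesis using qball_0_iff_residue[OF True b] by (simp add: \<beta>_def indicator_def)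
    next
      case False
      moreover have "x \<in> disc N" if "x \<in> qball 0 b"
        using that b by (auto simp: qball_def disc_def)
      ultimately have "x \<notin> qball 0 b" by blast
      moreover have "(\<Sum>j<n. cnj (u (\<beta> - int j)) * qp_transl p (frac_elt N j) f x) = 0"
        using False transl by (intro sum.neutral) auto
      ultimately show ?thesis by simp
    qed
  qed
qed

text \<open>Both inclusions are checked on generators; the disc is first enlarged to contain the
  translation or the centre of the ball, which preserves \<open>m = N\<close>.\<close>

lemma transl_span_eq_haar_space:
  assumes f: "is_step N N u f"
    and orth: "\<forall>a\<in>Ip p. \<forall>b\<in>Ip p. l2inner p (qp_transl p a f) (qp_transl p b f) = (if a = b then 1 else 0)"
  shows "l2_closure p (cspan {qp_transl p a f | a. a \<in> Ip p}) = haar_space 0"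
proof
  have sub: "{qp_transl p a f | a. a \<in> Ip p} \<subseteq> L2 p"
    using transl_subset_L2[OF f] by (auto simp: Ip_iff)
  have "{qp_transl p a f | a. a \<in> Ip p} \<subseteq> haar_space 0"
  proof
    fix g assume "g \<in> {qp_transl p a f | a. a \<in> Ip p}"
    then obtain a where a: "a \<in> Qp p" and g: "g = qp_transl p a f" by (auto simp: Ip_iff)
    obtain M v where M: "a \<in> disc M" "is_step M M v f" using is_step_square_disc[OF f a] .
    show "g \<in> haar_space 0" unfolding g by (rule is_step_in_haar_space[OF is_step_transl[OF M(2,1)]])
  qed
  then show "l2_closure p (cspan {qp_transl p a f | a. a \<in> Ip p}) \<subseteq> haar_space 0"
    unfolding haar_space_def by (intro l2_closure_cspan_minimal ball_indicators_subset_L2)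
  have "ball_indicators 0 \<subseteq> l2_closure p (cspan {qp_transl p a f | a. a \<in> Ip p})"
  proof
    fix g assume "g \<in> ball_indicators 0"
    then obtain b where b: "b \<in> Qp p" and g: "g = indicator (qball 0 b)" by (auto simp: ball_indicators_def)
    obtain M v where M: "b \<in> disc M" "is_step M M v f" using is_step_square_disc[OF f b] .
    show "g \<in> l2_closure p (cspan {qp_transl p a f | a. a \<in> Ip p})"
      unfolding g by (rule qball_indicator_in_transl_span[OF M(2,1) orth])
  qed
  then show "haar_space 0 \<subseteq> l2_closure p (cspan {qp_transl p a f | a. a \<in> Ip p})"
    unfolding haar_space_def by (intro l2_closure_cspan_minimal sub)
qed

text \<open>On the disc of level \<open>N + 1\<close> the scaling function has the sequence
  \<open>inflate p u\<close>, while the dilate \<open>g\<close> of a translate keeps the shifted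
  \<open>u\<close>. As \<open>g\<close> lies in \<open>V 0\<close>,
  \<open>is_step_refinement\<close> yields the refinement hypothesis of
  \<open>refinable_orthogonal_periodic\<close>.\<close>

lemma MRA_base_space:
  assumes V: "is_MRA p V" and test: "qp_test p f" and scal: "is_orth_scaling_function p V f"
  shows "V 0 = haar_space 0"
proof -
  obtain N m u where f: "N \<le> m" "is_step N m u f" using qp_test_imp_is_step[OF test] by blast
  have orth: "\<forall>a\<in>Ip p. \<forall>b\<in>Ip p. l2inner p (qp_transl p a f) (qp_transl p b f) = (if a = b then 1 else 0)"
    and V0: "V 0 = l2_closure p (cspan {qp_transl p a f | a. a \<in> Ip p})"
    using scal by (auto simp: is_orth_scaling_function_def is_scaling_function_def)
  have f': "is_step (Suc N) (Suc m) (inflate p u) f" by (rule is_step_inflate[OF f(2)])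
  have S: "cspan {qp_transl p a f | a. a \<in> Ip p} \<subseteq> L2 p"
    using transl_subset_L2[OF f(2)] by (intro cspan_subset_L2) (auto simp: Ip_iff)
  have refine: "\<exists>c. \<forall>r. u (r - int k) = (\<Sum>j<p * p ^ N. c j * inflate p u (r - int j))" if k: "k < p ^ N" for k
  proof -
    define h where "h = qp_transl p (frac_elt N k) f"
    define g where "g = (\<lambda>x. h (qp_ppow 1 x))"
    have "is_step N m (\<lambda>r. u (r - int k)) h"
      unfolding h_def by (rule is_step_transl_frac_elt[OF f(2) k f(1)])
    then have "is_step (Suc N) m (\<lambda>r. u (r - int k)) g"
      unfolding g_def by (rule is_step_dilate)
    then have g: "is_step (Suc N) (Suc m) (\<lambda>r. u (r - int k)) g"
      by (rule is_step_refine) simp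
    have "h \<in> {qp_transl p a f | a. a \<in> Ip p}"
      using frac_elt_in_Ip[OF k] by (auto simp: h_def)
    then have "h \<in> V 0"
      unfolding V0 by (rule subsetD[OF l2_closure_superset[OF S] subsetD[OF cspan_superset]])
    \<comment> \<open>The inclusion of \<open>V 0\<close> in \<open>V 1\<close>, followed by the
      dilation axiom read backwards, puts \<open>g\<close> into \<open>V 0\<close>.\<close>
    moreover have "V 0 \<subseteq> V (0 + 1)" using V unfolding is_MRA_def by blast
    ultimately have "h \<in> V (0 + 1)" by blast
    moreover have "h = (\<lambda>x. g (qp_ppow (-1) x))" by (simp add: g_def)
    ultimately have "(\<lambda>x. g (qp_ppow (-1) x)) \<in> V (0 + 1)" by simp
    then have "g \<in> V 0" using V unfolding is_MRA_def by blast
    then show ?thesis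
      using is_step_refinement[OF f' _ orth g] f(1) unfolding V0 by simp
  qed
  have "u (r - int (p ^ N)) = u r" for r
  proof (rule refinable_orthogonal_periodic[OF p_gt_1 _ _ _ _ _ refine])
    show "p ^ m = p ^ N * p ^ (m - N)" using f(1) by (simp flip: power_add)
    show "u (r + int (p ^ m)) = u r" for r using f(2) by (simp add: is_step_def)
    show "(\<Sum>r\<in>{0..<int (p ^ m)}. u (r - int k) * cnj (u (r - int l))) =
      (if k = l then of_real (real p powr (real m - real N)) else 0)" if "k < p ^ N" "l < p ^ N" for k l
      using is_step_orthogonality[OF f(2,1) orth that] by simp
  qed auto
  \<comment> \<open>Periodicity modulo \<open>p^N\<close> means constancy on unit balls, so the
    level drops from \<open>m\<close> to \<open>N\<close>.\<close>
  from this[of "r + int (p ^ N)" for r] have "u (r + int p ^ N) = u r" for r by simp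
  then have "is_step N N u f" by (rule is_step_coarsen[OF f(2,1)])
  then show ?thesis unfolding V0 using orth by (rule transl_span_eq_haar_space)
qed

text \<open>The dilation axiom determines each space from either neighbour, so induction runs in
  both directions from 0.\<close>

lemma MRA_determined_by_base:
  assumes V: "is_MRA p V" and W: "is_MRA p W" and eq: "V 0 = W 0"
  shows "V j = W j"
proof -
  have dil: "f \<in> V j \<longleftrightarrow> (\<lambda>x. f (qp_ppow (-1) x)) \<in> V (j + 1)" if "is_MRA p V" for V f j
    using that by (simp add: is_MRA_def)
  have up: "V (i + 1) = {f. (\<lambda>x. f (qp_ppow 1 x)) \<in> V i}" if V: "is_MRA p V" for V i
    using dil[OF V, of "\<lambda>x. f (qp_ppow 1 x)" i for f] by auto
  have down: "V (i - 1) = {f. (\<lambda>x. f (qp_ppow (-1) x)) \<in> V i}" if V: "is_MRA p V" for V i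
    using dil[OF V, of _ "i - 1"] by auto
  show ?thesis
  proof (induction j rule: int_induct[where k = 0])
    case (step1 i)
    then show ?case by (simp add: up[OF V] up[OF W])
  next
    case (step2 i)
    then show ?case by (simp add: down[OF V] down[OF W])
  qed (rule eq)
qed

section \<open>Existence: the indicator of \<open>Z_p\<close> as scaling function\<close>

definition haar_phi :: "qp \<Rightarrow> complex" where
  "haar_phi = indicator (qball 0 qp_zero)"

lemma is_step_haar_phi: "is_step 0 0 (\<lambda>_. 1) haar_phi"
  using disc_eq_qball[of 0] by (simp add: is_step_def haar_phi_def indicator_def)

lemma haar_phi_transl:
  assumes "a \<in> Qp p" "x \<in> Qp p"
  shows "qp_transl p a haar_phi x = indicator (qball 0 a) x"
proof -
  have "qp_sub p x a \<in> qball 0 qp_zero \<longleftrightarrow> x \<in> qball 0 a"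
    using qp_sub_digits_zero_iff[OF assms(2,1), of 0] qp_sub_in_Qp[OF assms(2,1)] assms(2)
    unfolding qball_def qp_zero_def by blast
  then show ?thesis by (simp add: qp_transl_def haar_phi_def indicator_def)
qed

text \<open>Elements of \<open>Ip p\<close> are determined by their digits at negative positions, so
  distinct ones are centres of disjoint unit balls; each such ball has measure 1.\<close>

lemma haar_phi_orthonormal:
  assumes a: "a \<in> Ip p" and b: "b \<in> Ip p"
  shows "l2inner p (qp_transl p a haar_phi) (qp_transl p b haar_phi) = (if a = b then 1 else 0)"
proof -
  have Q: "a \<in> Qp p" "b \<in> Qp p" using a b by (auto simp: Ip_iff)
  have eq: "x \<in> qball 0 a \<and> x \<in> qball 0 b \<longleftrightarrow> x \<in> qball 0 a \<and> a = b" for x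
  proof -
    have "a = b" if "x \<in> qball 0 a" "x \<in> qball 0 b"
    proof
      fix k show "a k = b k"
        using that a b by (cases "k < 0") (auto simp: qball_def Ip_iff)
    qed
    then show ?thesis by auto
  qed
  have "l2inner p (qp_transl p a haar_phi) (qp_transl p b haar_phi) =
    (LINT x|haar p. of_real (if a = b then indicator (qball 0 a) x else 0))"
    unfolding l2inner_def
  proof (intro Bochner_Integration.integral_cong refl)
    fix x assume "x \<in> space (haar p)"
    then show "qp_transl p a haar_phi x * cnj (qp_transl p b haar_phi x) =
      of_real (if a = b then indicator (qball 0 a) x else 0)"
      using eq[of x] Q by (auto simp: haar_phi_transl indicator_def)
  qed
  also have "\<dots> = (if a = b then 1 else 0)"
  proof (cases "a = b")
    case True
    have "(LINT x|haar p. indicator (qball 0 a) x :: real) = measure (haar p) (qball 0 a)"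
      using emeasure_qball[OF Q(1)] sets.Int_space_eq2[OF qball_sets, of 0 a] by simp
    then show ?thesis using True measure_qball[OF Q(1), of 0] by simp
  qed simp
  finally show ?thesis .
qed

lemma qp_test_haar_phi: "qp_test p haar_phi"
  unfolding qp_test_def
proof (intro conjI ballI)
  fix x assume x: "x \<in> Qp p"
  have "haar_phi y = haar_phi x" if y: "y \<in> Qp p" "qp_norm p (qp_sub p y x) < 1" for y
  proof -
    have "\<forall>k<0. qp_sub p y x k = 0"
      using qp_norm_less_imp_zero[OF qp_sub_in_Qp[OF y(1) x], of 0] y(2) by simp
    then have "\<forall>k<0. y k = x k" unfolding qp_sub_digits_zero_iff[OF y(1) x] .
    then show ?thesis using x y(1) by (simp add: haar_phi_def indicator_def qball_def)
  qed
  then show "\<exists>e>0. \<forall>y\<in>Qp p. qp_norm p (qp_sub p y x) < e \<longrightarrow> haar_phi y = haar_phi x"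
    by (intro exI[of _ 1]) auto
next
  have "haar_phi x = 0" if x: "x \<in> Qp p" "1 < qp_norm p x" for x
  proof (rule ccontr)
    assume "haar_phi x \<noteq> 0"
    then have "\<forall>k<0. x k = 0" by (auto simp: haar_phi_def indicator_def qball_def qp_zero_def split: if_splits)
    then show False using qp_norm_le[OF x(1), of 0] x(2) by simp
  qed
  then show "\<exists>R. \<forall>x\<in>Qp p. R < qp_norm p x \<longrightarrow> haar_phi x = 0" by blast
qed

lemma haar_orth_scaling: "is_orth_scaling_function p haar_space haar_phi"
  unfolding is_orth_scaling_function_def is_scaling_function_def
  using is_step_in_haar_space[OF is_step_haar_phi] haar_phi_orthonormal
    transl_span_eq_haar_space[OF is_step_haar_phi] by auto

lemma haar_MRA: "is_MRA p haar_space"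
  unfolding is_MRA_def
proof (intro conjI allI ballI)
  show "l2_closure p (\<Union>j. haar_space j) = L2 p"
    using haar_limit_eq_L2 by (simp add: haar_limit_def)
  show "\<exists>f. is_scaling_function p haar_space f"
    using haar_orth_scaling by (auto simp: is_orth_scaling_function_def)
  show "l2norm p f = 0" if "f \<in> (\<Inter>j. haar_space j)" for f
    using that by (intro haar_space_Inter) auto
qed (use haar_space_subset_L2 csubspace_haar_space l2_closure_haar_space haar_space_Suc
    haar_space_dilation_iff in auto)

end

theorem theorem10:
  fixes p :: nat
  assumes "prime p"
  shows "(\<exists>V phi. is_MRA p V \<and> qp_test p phi \<and> is_orth_scaling_function p V phi) \<and>
         (\<forall>V1 V2 phi1 phi2.
            is_MRA p V1 \<and> qp_test p phi1 \<and> is_orth_scaling_function p V1 phi1 \<and>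
            is_MRA p V2 \<and> qp_test p phi2 \<and> is_orth_scaling_function p V2 phi2
            \<longrightarrow> (\<forall>j. V1 j = V2 j))"
proof -
  interpret padic p by unfold_locales (rule prime_gt_1_nat[OF assms])
  show ?thesis
    using haar_MRA qp_test_haar_phi haar_orth_scaling MRA_base_space MRA_determined_by_base by metis
qed

end
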